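(* Let $s\in(0,1)$ and $p\in(1,+\infty)$. Assume $u\in C^2_b(\mathbb R^n)$ and $x_0\in\mathbb R^n$. If $p\in(1,\frac{2}{2-s})$ assume additionally that $\nabla u(x_0)\neq 0$. Then $$(-\Delta)_p^s u(x_0)=C_2(n,s,p)\int_0^{+\infty} e^{t\Delta}\big[\Phi_p(u(x_0)-u(\cdot))\big](x_0)\,\frac{dt}{t^{1+\frac{sp}{2}}},$$ where $$C_2(n,s,p)=\frac{\pi^{\frac n2}\,C_1(n,s,p)}{2^{sp}\,\Gamma\left(\frac{n+sp}{2}\right)}.$$
   Context: $C^2_b(\mathbb R^n)$ is the space of $C^2$ functions $\mathbb R^n\to\mathbb R$ that are bounded together with their derivatives up to order two. $\Phi_p(t)=|t|^{p-2}t$ (with $\Phi_p(0)=0$). The fractional $p$-Laplacian is defined pointwise by $$(-\Delta)_p^s u(x)=C_1(n,s,p)\,\mathrm{P.V.}\int_{\mathbb R^n}\frac{\Phi_p(u(x)-u(y))}{|x-y|^{n+sp}}\,dy,\qquad \mathrm{P.V.}\int_{\mathbb R^n}=\lim_{\varepsilon\to0^+}\int_{|x-y|>\varepsilon},$$ where $C_1(n,s,p)>0$ is a fixed constant. The heat semigroup is $$e^{t\Delta}[f](x)=\frac{1}{(4\pi t)^{n/2}}\int_{\mathbb R^n}e^{-\frac{|x-y|^2}{4t}}f(y)\,dy,\qquad t>0.$$ In the formula, $e^{t\Delta}$ acts on the function $y\mapsto\Phi_p(u(x_0)-u(y))$ and the result is evaluated at $x_0$.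
   Formalization: For p = 2/(2-s) with ∇u(x_0) = 0 both sides may diverge (e.g. at a nondegenerate minimum), so there the formula is stated in the extended sense: the P.V. has a limit L in [-∞,+∞] iff the integral over (δ,∞) tends to L as δ→0+; otherwise it is literal. *)

theory Defs
  imports "HOL-Analysis.Analysis"
begin

definition gradient :: "(real ^ 'n \<Rightarrow> real) \<Rightarrow> real ^ 'n \<Rightarrow> real ^ 'n" where
  "gradient u x = (THE g. GDERIV u x :> g)"

text \<open>The space of \<open>C\<^sup>2\<close> functions that are bounded together with their derivatives up to
  order two; \<open>g\<close> is the gradient and \<open>H\<close> the Hessian matrix.\<close>

definition C2b :: "(real ^ 'n \<Rightarrow> real) set" where
  "C2b = {u. \<exists>(g :: real ^ 'n \<Rightarrow> real ^ 'n) (H :: real ^ 'n \<Rightarrow> real ^ 'n ^ 'n).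
      (\<forall>x. GDERIV u x :> g x) \<and>
      (\<forall>x. (g has_derivative (\<lambda>h. H x *v h)) (at x)) \<and>
      continuous_on UNIV H \<and>
      bounded (range u) \<and> bounded (range g) \<and> bounded (range H)}"

text \<open>Since \<open>0 powr a = 0\<close>, this gives \<open>Phi p 0 = 0\<close> for every \<open>p\<close>.\<close>

definition Phi :: "real \<Rightarrow> real \<Rightarrow> real" where
  "Phi p t = \<bar>t\<bar> powr (p - 2) * t"

definition pv_trunc :: "(real ^ 'n \<Rightarrow> real) \<Rightarrow> real ^ 'n \<Rightarrow> real \<Rightarrow> real" where
  "pv_trunc f x \<epsilon> = (LINT y:{y. norm (x - y) > \<epsilon>}|lborel. f y)"

definition pv_exists :: "(real ^ 'n \<Rightarrow> real) \<Rightarrow> real ^ 'n \<Rightarrow> bool" where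
  "pv_exists f x \<longleftrightarrow> (\<exists>l. (pv_trunc f x \<longlongrightarrow> l) (at_right 0))"

text \<open>Only meaningful if \<open>pv_exists f x\<close>.\<close>

definition pv_integral :: "(real ^ 'n \<Rightarrow> real) \<Rightarrow> real ^ 'n \<Rightarrow> real" where
  "pv_integral f x = Lim (at_right 0) (pv_trunc f x)"

definition frac_kernel :: "real \<Rightarrow> real \<Rightarrow> (real ^ 'n \<Rightarrow> real) \<Rightarrow> real ^ 'n \<Rightarrow> real ^ 'n \<Rightarrow> real" where
  "frac_kernel s p u x y =
     Phi p (u x - u y) / norm (x - y) powr (real CARD('n) + s * p)"

text \<open>The normalisation \<open>C1\<close> is an arbitrary function of \<open>(n, s, p)\<close>.\<close>

definition frac_p_laplacian ::
    "(nat \<Rightarrow> real \<Rightarrow> real \<Rightarrow> real) \<Rightarrow> real \<Rightarrow> real \<Rightarrow> (real ^ 'n \<Rightarrow> real) \<Rightarrow> real ^ 'n \<Rightarrow> real" where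
  "frac_p_laplacian C1 s p u x = C1 CARD('n) s p * pv_integral (frac_kernel s p u x) x"

definition heat_semigroup :: "real \<Rightarrow> (real ^ 'n \<Rightarrow> real) \<Rightarrow> real ^ 'n \<Rightarrow> real" where
  "heat_semigroup t f x =
     1 / (4 * pi * t) powr (real CARD('n) / 2) *
     (LINT y|lborel. exp (- (norm (x - y))\<^sup>2 / (4 * t)) * f y)"

definition semigroup_integrand ::
    "real \<Rightarrow> real \<Rightarrow> (real ^ 'n \<Rightarrow> real) \<Rightarrow> real ^ 'n \<Rightarrow> real \<Rightarrow> real" where
  "semigroup_integrand s p u x t =
     heat_semigroup t (\<lambda>y. Phi p (u x - u y)) x / t powr (1 + s * p / 2)"

definition C2 :: "(nat \<Rightarrow> real \<Rightarrow> real \<Rightarrow> real) \<Rightarrow> nat \<Rightarrow> real \<Rightarrow> real \<Rightarrow> real" where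
  "C2 C1 n s p =
     pi powr (real n / 2) * C1 n s p / (2 powr (s * p) * Gamma ((real n + s * p) / 2))"

text \<open>The identity as an equality of possibly infinite or undefined quantities: the principal
  value has a limit in the extended reals iff the improper integral over \<open>(0, \<infinity>)\<close> does, and
  then the two limits agree. It covers the borderline case \<open>p = 2 / (2 - s)\<close> with
  \<open>gradient u x = 0\<close>, where neither side need be finite: there the truncated
  integrals diverge logarithmically to \<open>-\<infinity>\<close> if, say, \<open>u\<close> has a nondegenerate local minimum
  at \<open>x\<close>.\<close>

definition extended_identity ::
    "(nat \<Rightarrow> real \<Rightarrow> real \<Rightarrow> real) \<Rightarrow> real \<Rightarrow> real \<Rightarrow> (real ^ 'n \<Rightarrow> real) \<Rightarrow> real ^ 'n \<Rightarrow> bool" where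
  "extended_identity C1 s p u x \<longleftrightarrow>
     (\<forall>L :: ereal.
        ((\<lambda>\<epsilon>. ereal (C1 CARD('n) s p * pv_trunc (frac_kernel s p u x) x \<epsilon>)) \<longlongrightarrow> L) (at_right 0)
        \<longleftrightarrow>
        ((\<lambda>\<delta>. ereal (C2 C1 CARD('n) s p * (LINT t:{\<delta><..}|lborel. semigroup_integrand s p u x t)))
           \<longlongrightarrow> L) (at_right 0))"

end

theory Submission
  imports Defs "HOL-Probability.Distributions"
begin

text \<open>Write \<open>f z = \<Phi>\<^sub>p (u x\<^sub>0 - u (x\<^sub>0 + z))\<close> and \<open>\<beta> = (n + s p) / 2\<close>. Since
  \<open>\<integral> t powr (- 1 - \<beta>) * exp (- r\<^sup>2 / (4 t)) dt\<close> over \<open>(0, \<infinity>)\<close> equals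
  \<open>4\<^sup>\<beta> \<Gamma>(\<beta>) r powr (- 2 \<beta>)\<close>, the formula is Fubini's theorem once the even part of \<open>f\<close> is
  absolutely integrable against \<open>norm z powr (- 2 \<beta>)\<close>. This holds because the even part is bounded by a
  function that is homogeneous of degree \<open>\<gamma> > s p\<close> and integrable against Gaussians:
  \<open>norm z powr p\<close> for \<open>p \<ge> 2\<close>, \<open>(norm z)\<^sup>2 * \<bar>\<nabla>u \<bullet> z\<bar> powr (p - 2)\<close> for \<open>p < 2\<close> and nonzero
  gradient, and \<open>norm z powr (2 p - 2)\<close> for zero gradient.

  In the critical case \<open>p = 2 / (2 - s)\<close> with zero gradient the integrals may diverge. There
  \<open>f\<close> is asymptotic at \<open>0\<close> to a function \<open>q\<close> homogeneous of degree \<open>s p\<close>, and the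
  difference of the heat integral over \<open>(\<delta>, \<infinity>)\<close> and the singular integral truncated at
  \<open>sqrt \<delta>\<close> converges to a multiple of the spherical mean of \<open>q\<close>. If this mean vanishes the two
  truncations have the same limits; otherwise both diverge to the same infinity.\<close>

text \<open>With a nonzero gradient the odd part of \<open>f\<close> is only of order
  \<open>norm z powr (p - 1)\<close> near 0, which is not absolutely integrable against the singular
  kernel if \<open>s p \<ge> p - 1\<close>; it has to cancel. It does, because both the truncation
  \<open>norm z > \<epsilon>\<close> and the Gaussians are radial. Homogeneous majorants suit the
  heat side: the scaling \<open>z = sqrt t w\<close> turns their integral against
  \<open>heat_weight\<close> into a constant times \<open>t powr ((\<gamma> - s p) / 2 - 1)\<close>,
  integrable at 0 exactly for \<open>\<gamma> > s p\<close>. A single Gaussian integral thus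
  replaces polar coordinates, even for a majorant that is singular along a hyperplane, and
  boundedness of \<open>f\<close> settles large \<open>t\<close>. The threshold
  \<open>2 / (2 - s)\<close> is where \<open>2 p - 2 = s p\<close>. There the majorant has exactly
  the critical degree, so neither integral can be treated alone and only their difference is
  accessible. The spherical mean enters because a radial kernel sees nothing else of a homogeneous
  function.\<close>

lemma nn_integral_lborel_scaleR:
  fixes f :: "'a::euclidean_space \<Rightarrow> ennreal"
  assumes [measurable]: "f \<in> borel_measurable borel" and "c \<noteq> 0"
  shows "(\<integral>\<^sup>+x. f x \<partial>lborel) = ennreal (\<bar>c\<bar> ^ DIM('a)) * (\<integral>\<^sup>+x. f (c *\<^sub>R x) \<partial>lborel)"
proof -
  have "(\<integral>\<^sup>+x. f x \<partial>lborel) =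
      (\<integral>\<^sup>+x. f x \<partial>density (distr lborel borel (\<lambda>x::'a. 0 + c *\<^sub>R x)) (\<lambda>_. \<bar>c\<bar> ^ DIM('a)))"
    using lborel_affine[of c "0::'a"] \<open>c \<noteq> 0\<close> by simp
  also have "\<dots> = ennreal (\<bar>c\<bar> ^ DIM('a)) * (\<integral>\<^sup>+x. f (c *\<^sub>R x) \<partial>lborel)"
    by (simp add: nn_integral_density nn_integral_distr nn_integral_cmult)
  finally show ?thesis .
qed

lemma lborel_integral_scaleR:
  fixes f :: "'a::euclidean_space \<Rightarrow> real"
  assumes [measurable]: "f \<in> borel_measurable borel" and "c \<noteq> 0"
  shows "integrable lborel (\<lambda>x. f (c *\<^sub>R x)) \<longleftrightarrow> integrable lborel f"
    and "(\<integral>x. f x \<partial>lborel) = \<bar>c\<bar> ^ DIM('a) * (\<integral>x. f (c *\<^sub>R x) \<partial>lborel)"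
proof -
  have *: "lborel = density (distr lborel borel (\<lambda>x::'a. c *\<^sub>R x)) (\<lambda>_. ennreal (\<bar>c\<bar> ^ DIM('a)))"
    using lborel_affine[of c "0::'a"] \<open>c \<noteq> 0\<close> by simp
  show "integrable lborel (\<lambda>x. f (c *\<^sub>R x)) \<longleftrightarrow> integrable lborel f"
    using \<open>c \<noteq> 0\<close> by (subst (2) *) (simp add: integrable_density integrable_distr_eq)
  show "(\<integral>x. f x \<partial>lborel) = \<bar>c\<bar> ^ DIM('a) * (\<integral>x. f (c *\<^sub>R x) \<partial>lborel)"
    by (subst *) (simp add: integral_density integral_distr)
qed

lemma nn_integral_lborel_translate:
  fixes f :: "'a::euclidean_space \<Rightarrow> ennreal"
  assumes [measurable]: "f \<in> borel_measurable borel"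
  shows "(\<integral>\<^sup>+x. f (a + x) \<partial>lborel) = (\<integral>\<^sup>+x. f x \<partial>lborel)"
  by (subst (2) lborel_distr_plus[of a, symmetric]) (simp add: nn_integral_distr)

lemma integral_lborel_translate:
  fixes f :: "'a::euclidean_space \<Rightarrow> real"
  assumes [measurable]: "f \<in> borel_measurable borel"
  shows "(\<integral>x. f (a + x) \<partial>lborel) = (\<integral>x. f x \<partial>lborel)"
  by (subst (2) lborel_distr_plus[of a, symmetric]) (simp add: integral_distr)

section \<open>Gaussians with polynomial and singular weights\<close>

lemma integrable_gaussian_real:
  assumes "c > 0"
  shows "integrable lborel (\<lambda>x::real. exp (- c * x\<^sup>2))"
proof -
  \<comment> \<open>With variance \<open>1 / (2 c)\<close> the normal density is this Gaussian up to
    its normalising factor.\<close>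
  define \<sigma> where "\<sigma> = sqrt (1 / (2 * c))"
  have \<sigma>: "\<sigma> > 0" "2 * \<sigma>\<^sup>2 = 1 / c"
    using assms by (auto simp: \<sigma>_def)
  have "integrable lborel (\<lambda>x. sqrt (2 * pi * \<sigma>\<^sup>2) * normal_density 0 \<sigma> x)"
    using \<sigma> by (intro integrable_mult_right integrable_normal_density) auto
  also have "(\<lambda>x. sqrt (2 * pi * \<sigma>\<^sup>2) * normal_density 0 \<sigma> x) = (\<lambda>x. exp (- c * x\<^sup>2))"
    using \<sigma> by (auto simp: normal_density_def fun_eq_iff)
  finally show ?thesis .
qed

text \<open>The squared norm is a sum over \<open>Basis\<close>, so the Gaussian is a product of
  one-dimensional ones and its integral a power of theirs.\<close>

lemma integrable_gaussian:
  assumes "c > 0"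
  shows "integrable lborel (\<lambda>z::'a::euclidean_space. exp (- c * (norm z)\<^sup>2))"
proof (rule integrableI_nonneg)
  have eq: "exp (- c * (norm z)\<^sup>2) = (\<Prod>b\<in>Basis. exp (- c * (z \<bullet> b)\<^sup>2))" for z :: 'a
  proof -
    have "(norm z)\<^sup>2 = (\<Sum>b\<in>Basis. (z \<bullet> b)\<^sup>2)"
      by (subst power2_norm_eq_inner, subst euclidean_inner) (simp add: power2_eq_square)
    then show ?thesis
      by (simp add: sum_distrib_left flip: exp_sum sum_negf)
  qed
  have fin: "(\<integral>\<^sup>+x. ennreal (exp (- c * (x::real)\<^sup>2)) \<partial>lborel) < \<infinity>"
    using integrable_gaussian_real[OF assms] by (subst nn_integral_eq_integral) auto
  have "(\<integral>\<^sup>+z. ennreal (exp (- c * (norm (z::'a))\<^sup>2)) \<partial>lborel)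
      = (\<integral>\<^sup>+z. (\<Prod>b\<in>Basis. ennreal (exp (- c * ((z::'a) \<bullet> b)\<^sup>2))) \<partial>lborel)"
    by (simp only: eq prod_ennreal exp_ge_zero)
  also have "\<dots> = (\<integral>\<^sup>+x. ennreal (exp (- c * (x::real)\<^sup>2)) \<partial>lborel) ^ DIM('a)"
    by (subst nn_integral_lborel_prod) auto
  also have "\<dots> < \<infinity>"
    using fin power_less_top_ennreal by auto
  finally show "(\<integral>\<^sup>+z. ennreal (exp (- c * (norm (z::'a))\<^sup>2)) \<partial>lborel) < \<infinity>" .
qed auto

text \<open>Half of the Gaussian absorbs the power:
  \<open>r powr \<gamma> \<le> exp (\<gamma> * r)\<close> because \<open>ln r \<le> r\<close>, and
  \<open>\<gamma> * r\<close> is estimated by completing a square.\<close>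

lemma powr_gaussian_le:
  fixes r \<gamma> c :: real
  assumes "c > 0" "\<gamma> \<ge> 0" "r \<ge> 0"
  shows "r powr \<gamma> * exp (- c * r\<^sup>2) \<le> exp (\<gamma>\<^sup>2 / (2 * c)) * exp (- (c / 2) * r\<^sup>2)"
proof -
  have "r powr \<gamma> \<le> exp (\<gamma> * r)"
  proof (cases "r = 0")
    case False
    then have "ln r \<le> r" using assms ln_le_minus_one[of r] by simp
    then show ?thesis using False assms by (simp add: powr_def mult_left_mono)
  qed auto
  also have "\<gamma> * r \<le> \<gamma>\<^sup>2 / (2 * c) + c / 2 * r\<^sup>2"
  proof -
    have "0 \<le> (\<gamma> - c * r)\<^sup>2 / (2 * c)" using assms by simp
    also have "\<dots> = \<gamma>\<^sup>2 / (2 * c) + c / 2 * r\<^sup>2 - \<gamma> * r"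
      using assms by (simp add: power2_eq_square field_simps)
    finally show ?thesis by simp
  qed
  then have "exp (\<gamma> * r) \<le> exp (\<gamma>\<^sup>2 / (2 * c) + c / 2 * r\<^sup>2)" by simp
  finally have "r powr \<gamma> * exp (- c * r\<^sup>2) \<le> exp (\<gamma>\<^sup>2 / (2 * c) + c / 2 * r\<^sup>2) * exp (- c * r\<^sup>2)"
    by (rule mult_right_mono) auto
  also have "\<dots> = exp (\<gamma>\<^sup>2 / (2 * c)) * exp (- (c / 2) * r\<^sup>2)"
    by (simp flip: exp_add)
  finally show ?thesis .
qed

lemma integrable_powr_gaussian:
  assumes "c > 0" "\<gamma> \<ge> 0"
  shows "integrable lborel (\<lambda>z::'a::euclidean_space. norm z powr \<gamma> * exp (- c * (norm z)\<^sup>2))"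
proof (rule Bochner_Integration.integrable_bound)
  show "integrable lborel (\<lambda>z::'a. exp (\<gamma>\<^sup>2 / (2 * c)) * exp (- (c / 2) * (norm z)\<^sup>2))"
    using assms by (intro integrable_mult_right integrable_gaussian) auto
qed (use powr_gaussian_le[OF assms] in \<open>auto simp: abs_mult\<close>)

lemma nn_integral_powr_interval_finite:
  assumes "\<theta> > -1"
  shows "(\<integral>\<^sup>+x\<in>{-1..1}. ennreal (\<bar>x\<bar> powr \<theta>) \<partial>lborel) < \<infinity>"
proof -
  have 1: "(\<integral>\<^sup>+x\<in>{0..1}. ennreal (\<bar>x\<bar> powr \<theta>) \<partial>lborel) = ennreal (1 / (\<theta> + 1))"
  proof -
    have "(\<integral>\<^sup>+x\<in>{0..1}. ennreal (x powr \<theta>) \<partial>lborel) = ennreal (1 powr (\<theta> + 1) / (\<theta> + 1))"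
      using assms by (intro nn_integral_has_integral_lebesgue' has_integral_powr_from_0) auto
    moreover have "(\<integral>\<^sup>+x\<in>{0..1}. ennreal (\<bar>x\<bar> powr \<theta>) \<partial>lborel) = (\<integral>\<^sup>+x\<in>{0..1}. ennreal (x powr \<theta>) \<partial>lborel)"
      by (intro nn_integral_cong) (auto split: split_indicator)
    ultimately show ?thesis by simp
  qed
  have 2: "(\<integral>\<^sup>+x\<in>{-1..0}. ennreal (\<bar>x\<bar> powr \<theta>) \<partial>lborel) = (\<integral>\<^sup>+x\<in>{0..1}. ennreal (\<bar>x\<bar> powr \<theta>) \<partial>lborel)"
    by (subst nn_integral_lborel_scaleR[where c = "-1"])
       (auto intro!: nn_integral_cong split: split_indicator)
  have "(\<integral>\<^sup>+x\<in>{-1..1}. ennreal (\<bar>x\<bar> powr \<theta>) \<partial>lborel) \<le>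
      (\<integral>\<^sup>+x. ennreal (\<bar>x\<bar> powr \<theta>) * indicator {-1..0} x + ennreal (\<bar>x\<bar> powr \<theta>) * indicator {0..1} x \<partial>lborel)"
    by (intro nn_integral_mono) (auto split: split_indicator)
  also have "\<dots> = ennreal (1 / (\<theta> + 1)) + ennreal (1 / (\<theta> + 1))"
    by (subst nn_integral_add) (simp_all add: 1 2)
  also have "\<dots> < \<infinity>" by simp
  finally show ?thesis .
qed

text \<open>Averaging over translations in the direction \<open>e\<close> replaces the singular weight by its
  integral over an interval.\<close>

lemma integrable_inner_powr_gaussian:
  fixes e :: "'a::euclidean_space"
  assumes "e \<noteq> 0" "-1 < \<theta>" "\<theta> \<le> 0" "c > 0"
  shows "integrable lborel (\<lambda>z. \<bar>e \<bullet> z\<bar> powr \<theta> * exp (- c * (norm z)\<^sup>2))"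
proof (rule integrableI_nonneg)
  \<comment> \<open>The part of the weight around its singularity, of finite integral because
    \<open>\<theta> > -1\<close>.\<close>
  define k where "k x = \<bar>x\<bar> powr \<theta> * indicator {-1..1} x" for x :: real
  have [measurable]: "k \<in> borel_measurable borel" unfolding k_def by measurable
  have k0: "0 \<le> k x" for x by (simp add: k_def)
  \<comment> \<open>Chosen so that moving \<open>z\<close> by \<open>h *\<^sub>R e'\<close> adds
    exactly \<open>h\<close> to \<open>e \<bullet> z\<close>.\<close>
  define e' where "e' = e /\<^sub>R (norm e)\<^sup>2"
  have e': "e \<bullet> e' = 1" using assms(1) by (simp add: e'_def power2_norm_eq_inner)
  define J where "J = (\<integral>\<^sup>+x. k x \<partial>lborel)"
  have J: "J < \<infinity>"
    using nn_integral_powr_interval_finite[OF assms(2)]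
    by (simp add: J_def k_def ennreal_mult' ennreal_indicator mult.commute)
  \<comment> \<open>The price of a shift by at most \<open>norm e'\<close>: half of the Gaussian
    exponent survives and this factor is lost.\<close>
  define C where "C = exp (c * (norm e')\<^sup>2)"
  have shift: "exp (- c * (norm (h *\<^sub>R e' + z))\<^sup>2) \<le> C * exp (- (c/2) * (norm z)\<^sup>2)"
    if "h \<in> {0..1}" for h z
  proof -
    have "norm z \<le> norm (h *\<^sub>R e' + z) + norm (h *\<^sub>R e')"
      by (metis add_diff_cancel_left' norm_triangle_ineq4)
    also have "norm (h *\<^sub>R e') \<le> norm e'"
      using that by (simp add: mult_left_le_one_le)
    finally have "(norm z)\<^sup>2 \<le> (norm (h *\<^sub>R e' + z) + norm e')\<^sup>2"
      by (intro power_mono) auto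
    also have "\<dots> \<le> 2 * (norm (h *\<^sub>R e' + z))\<^sup>2 + 2 * (norm e')\<^sup>2"
      using sum_squares_bound[of "norm (h *\<^sub>R e' + z)" "norm e'"] by (simp add: power2_sum)
    finally have "c * (norm z)\<^sup>2 \<le> c * (2 * (norm (h *\<^sub>R e' + z))\<^sup>2 + 2 * (norm e')\<^sup>2)"
      using assms(4) by (intro mult_left_mono) auto
    then show ?thesis
      unfolding C_def by (simp flip: exp_add add: algebra_simps)
  qed
  have "(\<integral>\<^sup>+z. ennreal (k (e \<bullet> z) * exp (- c * (norm z)\<^sup>2)) \<partial>lborel) =
      (\<integral>\<^sup>+h. (\<integral>\<^sup>+z. ennreal (k (e \<bullet> z) * exp (- c * (norm z)\<^sup>2)) \<partial>lborel) * indicator {0..1::real} h \<partial>lborel)"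
    by (subst nn_integral_cmult_indicator) auto
  also have "\<dots> \<le> (\<integral>\<^sup>+h. (\<integral>\<^sup>+z. ennreal (k (e \<bullet> z + h) * (C * exp (- (c/2) * (norm z)\<^sup>2))) \<partial>lborel) \<partial>lborel)"
  proof (intro nn_integral_mono)
    fix h :: real
    have "(\<integral>\<^sup>+z. ennreal (k (e \<bullet> z) * exp (- c * (norm z)\<^sup>2)) \<partial>lborel) =
       (\<integral>\<^sup>+z. ennreal (k (e \<bullet> (h *\<^sub>R e' + z)) * exp (- c * (norm (h *\<^sub>R e' + z))\<^sup>2)) \<partial>lborel)"
      by (rule nn_integral_lborel_translate[symmetric]) measurable
    also have "\<dots> \<le> (\<integral>\<^sup>+z. ennreal (k (e \<bullet> z + h) * (C * exp (- (c/2) * (norm z)\<^sup>2))) \<partial>lborel)"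
      if "h \<in> {0..1}"
      using shift[OF that] k0
      by (intro nn_integral_mono ennreal_leI mult_mono) (auto simp: inner_add_right e' add.commute)
    finally show "(\<integral>\<^sup>+z. ennreal (k (e \<bullet> z) * exp (- c * (norm z)\<^sup>2)) \<partial>lborel) * indicator {0..1} h
      \<le> (\<integral>\<^sup>+z. ennreal (k (e \<bullet> z + h) * (C * exp (- (c/2) * (norm z)\<^sup>2))) \<partial>lborel)"
      by (auto split: split_indicator)
  qed
  also have "\<dots> = (\<integral>\<^sup>+z. (\<integral>\<^sup>+h. ennreal (k (e \<bullet> z + h) * (C * exp (- (c/2) * (norm z)\<^sup>2))) \<partial>lborel) \<partial>lborel)"
    by (rule lborel_pair.Fubini') measurable
  also have "\<dots> = (\<integral>\<^sup>+z. J * ennreal (C * exp (- (c/2) * (norm z)\<^sup>2)) \<partial>(lborel :: 'a measure))"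
  proof (intro nn_integral_cong)
    fix z :: 'a
    have "(\<integral>\<^sup>+h. ennreal (k (e \<bullet> z + h) * (C * exp (- (c/2) * (norm z)\<^sup>2))) \<partial>lborel)
       = (\<integral>\<^sup>+h. ennreal (k (e \<bullet> z + h)) \<partial>lborel) * ennreal (C * exp (- (c/2) * (norm z)\<^sup>2))"
      by (subst nn_integral_multc[symmetric]) (auto simp: ennreal_mult' k0)
    also have "(\<integral>\<^sup>+h. ennreal (k (e \<bullet> z + h)) \<partial>lborel) = J"
      unfolding J_def by (rule nn_integral_lborel_translate) measurable
    finally show "(\<integral>\<^sup>+h. ennreal (k (e \<bullet> z + h) * (C * exp (- (c/2) * (norm z)\<^sup>2))) \<partial>lborel)
       = J * ennreal (C * exp (- (c/2) * (norm z)\<^sup>2))" .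
  qed
  also have "\<dots> = J * (\<integral>\<^sup>+z. ennreal (C * exp (- (c/2) * (norm z)\<^sup>2)) \<partial>(lborel :: 'a measure))"
    by (rule nn_integral_cmult) measurable
  also have "\<dots> < \<infinity>"
    using J integrable_gaussian[of "c/2", where 'a = 'a] assms(4)
    by (subst nn_integral_eq_integral) (auto simp: ennreal_mult_less_top C_def simp del: minus_mult_left)
  finally have fin: "(\<integral>\<^sup>+z. ennreal (k (e \<bullet> z) * exp (- c * (norm z)\<^sup>2)) \<partial>lborel) < \<infinity>" .
  have "(\<integral>\<^sup>+z. ennreal (\<bar>e \<bullet> z\<bar> powr \<theta> * exp (- c * (norm z)\<^sup>2)) \<partial>lborel) \<le>
    (\<integral>\<^sup>+z. ennreal (k (e \<bullet> z) * exp (- c * (norm z)\<^sup>2)) + ennreal (exp (- c * (norm z)\<^sup>2)) \<partial>lborel)"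
  proof (intro nn_integral_mono)
    fix z :: 'a
    \<comment> \<open>Where \<open>\<bar>e \<bullet> z\<bar> > 1\<close> the weight is at most 1,
      since \<open>\<theta> \<le> 0\<close>; elsewhere it equals \<open>k\<close>.\<close>
    have "\<bar>e \<bullet> z\<bar> powr \<theta> \<le> k (e \<bullet> z) + 1"
    proof (cases "\<bar>e \<bullet> z\<bar> \<le> 1")
      case True then show ?thesis by (auto simp: k_def indicator_def abs_le_iff)
    next
      case False
      then have "\<bar>e \<bullet> z\<bar> powr \<theta> \<le> 1 powr \<theta>" using assms by (intro powr_mono2') auto
      then show ?thesis using k0[of "e \<bullet> z"] by simp
    qed
    then have "\<bar>e \<bullet> z\<bar> powr \<theta> * exp (- c * (norm z)\<^sup>2) \<le> (k (e \<bullet> z) + 1) * exp (- c * (norm z)\<^sup>2)"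
      by (rule mult_right_mono) simp
    also have "\<dots> = k (e \<bullet> z) * exp (- c * (norm z)\<^sup>2) + exp (- c * (norm z)\<^sup>2)"
      by (simp add: algebra_simps)
    finally show "ennreal (\<bar>e \<bullet> z\<bar> powr \<theta> * exp (- c * (norm z)\<^sup>2)) \<le>
      ennreal (k (e \<bullet> z) * exp (- c * (norm z)\<^sup>2)) + ennreal (exp (- c * (norm z)\<^sup>2))"
      by (subst ennreal_plus[symmetric]) (auto simp: k0 intro!: ennreal_leI simp del: ennreal_plus)
  qed
  also have "\<dots> < \<infinity>"
    using fin integrable_gaussian[OF assms(4), where 'a = 'a]
    by (subst nn_integral_add) (auto simp: nn_integral_eq_integral)
  finally show "(\<integral>\<^sup>+z. ennreal (\<bar>e \<bullet> z\<bar> powr \<theta> * exp (- c * (norm z)\<^sup>2)) \<partial>lborel) < \<infinity>" .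
qed auto

subsection \<open>The heat kernel in time\<close>

text \<open>For \<open>\<beta> = (n + s p) / 2\<close> this is the heat kernel at distance
  \<open>r\<close> times \<open>t powr (- 1 - s p / 2)\<close>, without the constant
  \<open>(4 pi) powr (- n / 2)\<close>.\<close>

definition heat_weight :: "real \<Rightarrow> real \<Rightarrow> real \<Rightarrow> real" where
  "heat_weight \<beta> r t = t powr (- 1 - \<beta>) * exp (- r\<^sup>2 / (4 * t))"

text \<open>The radial kernel in space that Fubini produces from the times above
  \<open>\<delta>\<close>. For \<open>\<delta> = 0\<close> it is the singular kernel up to a
  constant; for \<open>\<delta> > 0\<close> it is a soft cut-off of that kernel around radius
  \<open>sqrt \<delta>\<close>.\<close>

definition heat_tail :: "real \<Rightarrow> real \<Rightarrow> real \<Rightarrow> real" where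
  "heat_tail \<beta> \<delta> r = (LINT t:{\<delta><..}|lborel. heat_weight \<beta> r t)"

lemma measurable_heat_weight [measurable]:
  assumes [measurable]: "f \<in> borel_measurable M" "g \<in> borel_measurable M"
  shows "(\<lambda>x. heat_weight \<beta> (f x) (g x)) \<in> borel_measurable M"
  unfolding heat_weight_def by measurable

lemma heat_weight_nonneg [simp]: "0 \<le> heat_weight \<beta> r t"
  by (simp add: heat_weight_def)

lemma heat_weight_le: "t > 0 \<Longrightarrow> heat_weight \<beta> r t \<le> t powr (- 1 - \<beta>)"
  unfolding heat_weight_def by (rule mult_left_le) auto

text \<open>The substitution \<open>t = r\<^sup>2 / (4 v)\<close>, an involution of the half-line,
  turns the exponent into \<open>- v\<close> and the integral into Euler's for
  \<open>Gamma \<beta>\<close>.\<close>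

lemma nn_integral_heat_weight:
  assumes "\<beta> > 0" "r > 0"
  shows "(\<integral>\<^sup>+t\<in>{0<..}. ennreal (heat_weight \<beta> r t) \<partial>lborel) = ennreal (4 powr \<beta> * Gamma \<beta> * r powr (- 2 * \<beta>))"
proof -
  define g where "g v = r\<^sup>2 / (4 * v)" for v :: real
  define g' where "g' v = - r\<^sup>2 / (4 * v\<^sup>2)" for v :: real
  have img: "g ` {0<..} = {0<..}"
  proof (intro antisym subsetI)
    fix t :: real assume "t \<in> {0<..}"
    then have "t = g (r\<^sup>2 / (4 * t))" "r\<^sup>2 / (4 * t) \<in> {0<..}"
      using assms by (auto simp: g_def field_simps)
    then show "t \<in> g ` {0<..}" by blast
  qed (use assms in \<open>auto simp: g_def\<close>)
  have inj: "inj_on g {0<..}"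
    using assms by (auto simp: inj_on_def g_def field_simps)
  have der: "(g has_field_derivative g' v) (at v within {0<..})" if "v \<in> {0<..}" for v
    using that unfolding g_def g'_def
    by (auto intro!: derivative_eq_intros simp: power2_eq_square field_simps)
  have Gam: "((\<lambda>v. v powr (\<beta> - 1) / exp v) has_integral Gamma \<beta>) {0<..}"
  proof -
    have "((\<lambda>v. if v \<in> {0<..} then v powr (\<beta> - 1) / exp v else 0) has_integral Gamma \<beta>) {0..}"
      by (rule has_integral_spike[OF _ _ Gamma_integral_real[OF assms(1)], where S = "{0}"]) auto
    then show ?thesis by (subst (asm) has_integral_restrict) auto
  qed
  have eq: "\<bar>g' v\<bar> * heat_weight \<beta> r (g v) = (r\<^sup>2/4) powr (- \<beta>) * (v powr (\<beta> - 1) / exp v)"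
    if "v \<in> {0<..}" for v
  proof -
    have v: "v > 0" using that by simp
    have v1: "v powr (1 + \<beta>) = 1 / v powr (- 1 - \<beta>)"
      using powr_minus_divide[of v "- 1 - \<beta>"] by (simp add: add.commute)
    have "(r\<^sup>2 / (4 * v)) powr (- 1 - \<beta>) = (r\<^sup>2/4) powr (- 1 - \<beta>) * v powr (1 + \<beta>)"
      using v assms by (simp add: powr_divide powr_mult v1)
    moreover have "\<bar>g' v\<bar> = (r\<^sup>2/4) powr 1 * v powr (- 2)"
      using v assms by (simp add: g'_def powr_minus_divide)
    ultimately have "\<bar>g' v\<bar> * heat_weight \<beta> r (g v)
        = ((r\<^sup>2/4) powr 1 * (r\<^sup>2/4) powr (- 1 - \<beta>)) * (v powr (- 2) * v powr (1 + \<beta>)) * exp (- v)"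
      using v assms by (simp add: heat_weight_def g_def)
    also have "\<dots> = (r\<^sup>2/4) powr (- \<beta>) * v powr (\<beta> - 1) * exp (- v)"
      unfolding powr_add[symmetric] by (simp add: add.commute)
    finally show ?thesis by (simp add: exp_minus field_simps)
  qed
  have "((\<lambda>v. \<bar>g' v\<bar> * heat_weight \<beta> r (g v)) has_integral ((r\<^sup>2/4) powr (- \<beta>) * Gamma \<beta>)) {0<..}"
    using has_integral_mult_right[OF Gam, of "(r\<^sup>2/4) powr (- \<beta>)"]
    by (rule has_integral_eq[rotated]) (use eq in simp)
  then have *: "(\<lambda>v. \<bar>g' v\<bar> * heat_weight \<beta> r (g v)) absolutely_integrable_on {0<..} \<and>
     integral {0<..} (\<lambda>v. \<bar>g' v\<bar> * heat_weight \<beta> r (g v)) = (r\<^sup>2/4) powr (- \<beta>) * Gamma \<beta>"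
    by (auto simp: has_integral_iff intro!: nonnegative_absolutely_integrable_1)
  then have "heat_weight \<beta> r absolutely_integrable_on {0<..} \<and>
       integral {0<..} (heat_weight \<beta> r) = (r\<^sup>2/4) powr (- \<beta>) * Gamma \<beta>"
    by (subst (asm) has_absolute_integral_change_of_variables_1'[OF _ der inj]) (auto simp: img)
  then have "(heat_weight \<beta> r has_integral ((r\<^sup>2/4) powr (- \<beta>) * Gamma \<beta>)) {0<..}"
    using set_lebesgue_integral_eq_integral(1) by (auto simp: has_integral_iff)
  then have "(\<integral>\<^sup>+t\<in>{0<..}. ennreal (heat_weight \<beta> r t) \<partial>lborel) = ennreal ((r\<^sup>2/4) powr (- \<beta>) * Gamma \<beta>)"
    by (intro nn_integral_has_integral_lebesgue') auto
  also have "(r\<^sup>2/4) powr (- \<beta>) = 4 powr \<beta> * r powr (- 2 * \<beta>)"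
    using assms by (simp add: powr_divide powr_minus_divide powr_powr flip: powr_numeral)
  finally show ?thesis by (simp add: mult_ac)
qed

lemma set_integrableI_nn_integral:
  fixes f :: "'a \<Rightarrow> real"
  assumes [measurable]: "f \<in> borel_measurable M" "A \<in> sets M"
    and "\<And>x. x \<in> A \<Longrightarrow> 0 \<le> f x" and "(\<integral>\<^sup>+x\<in>A. ennreal (f x) \<partial>M) < \<infinity>"
  shows "set_integrable M A f"
  unfolding set_integrable_def
proof (rule integrableI_nonneg)
  have "(\<integral>\<^sup>+x. ennreal (indicator A x *\<^sub>R f x) \<partial>M) = (\<integral>\<^sup>+x\<in>A. ennreal (f x) \<partial>M)"
    by (intro nn_integral_cong) (auto split: split_indicator)
  then show "(\<integral>\<^sup>+x. ennreal (indicator A x *\<^sub>R f x) \<partial>M) < \<infinity>" using assms(4) by simp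
qed (use assms in \<open>auto split: split_indicator\<close>)

lemma set_integrable_heat_weight:
  assumes "\<beta> > 0" "r > 0"
  shows "set_integrable lborel {0<..} (heat_weight \<beta> r)"
  using nn_integral_heat_weight[OF assms] by (intro set_integrableI_nn_integral) auto

lemma heat_tail_0:
  assumes "\<beta> > 0" "r > 0"
  shows "heat_tail \<beta> 0 r = 4 powr \<beta> * Gamma \<beta> * r powr (- 2 * \<beta>)"
proof -
  have "ennreal (heat_tail \<beta> 0 r) = (\<integral>\<^sup>+t. ennreal (indicator {0<..} t *\<^sub>R heat_weight \<beta> r t) \<partial>lborel)"
    unfolding heat_tail_def set_lebesgue_integral_def
    using set_integrable_heat_weight[OF assms]
    by (intro nn_integral_eq_integral[symmetric]) (auto simp: set_integrable_def)
  also have "\<dots> = (\<integral>\<^sup>+t\<in>{0<..}. ennreal (heat_weight \<beta> r t) \<partial>lborel)"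
    by (intro nn_integral_cong) (auto split: split_indicator)
  finally show ?thesis
    using assms unfolding nn_integral_heat_weight[OF assms]
    by (subst (asm) ennreal_inj)
       (auto simp: heat_tail_def set_lebesgue_integral_def Gamma_real_pos intro!: Bochner_Integration.integral_nonneg)
qed

lemma nn_integral_powr_to_inf_finite:
  assumes "\<delta> > 0" "a > (0::real)"
  shows "(\<integral>\<^sup>+t\<in>{\<delta><..}. ennreal (t powr (- 1 - a)) \<partial>lborel) < \<infinity>"
proof -
  have "((\<lambda>t. t powr (- 1 - a)) has_integral - (\<delta> powr (- 1 - a + 1)) / (- 1 - a + 1)) {\<delta>..}"
    using assms by (intro has_integral_powr_to_inf) auto
  then have "(\<integral>\<^sup>+t\<in>{\<delta>..}. ennreal (t powr (- 1 - a)) \<partial>lborel) = ennreal (- (\<delta> powr (- 1 - a + 1)) / (- 1 - a + 1))"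
    by (intro nn_integral_has_integral_lebesgue') auto
  then have "(\<integral>\<^sup>+t\<in>{\<delta>..}. ennreal (t powr (- 1 - a)) \<partial>lborel) < \<infinity>" by simp
  moreover have "(\<integral>\<^sup>+t\<in>{\<delta><..}. ennreal (t powr (- 1 - a)) \<partial>lborel) \<le> (\<integral>\<^sup>+t\<in>{\<delta>..}. ennreal (t powr (- 1 - a)) \<partial>lborel)"
    by (intro nn_integral_mono) (auto split: split_indicator)
  ultimately show ?thesis by simp
qed

lemma set_integrable_powr_to_inf:
  "\<delta> > 0 \<Longrightarrow> a > (0::real) \<Longrightarrow> set_integrable lborel {\<delta><..} (\<lambda>t. t powr (- 1 - a))"
  using nn_integral_powr_to_inf_finite by (intro set_integrableI_nn_integral) auto

lemma set_integrable_heat_weight_tail: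
  assumes "\<beta> > 0" "\<delta> > 0"
  shows "set_integrable lborel {\<delta><..} (heat_weight \<beta> r)"
  using heat_weight_le assms
  by (intro set_integrable_bound[OF set_integrable_powr_to_inf[of \<delta> \<beta>]])
     (auto simp: set_borel_measurable_def)

lemma heat_tail_nonneg: "0 \<le> heat_tail \<beta> \<delta> r"
  unfolding heat_tail_def set_lebesgue_integral_def by (intro Bochner_Integration.integral_nonneg) auto

text \<open>Scaling \<open>t\<close> by \<open>\<delta>\<close> and \<open>r\<close> by
  \<open>sqrt \<delta>\<close> keeps \<open>r\<^sup>2 / t\<close>; the power of \<open>t\<close>
  contributes \<open>\<delta> powr (- 1 - \<beta>)\<close> and the measure one more
  \<open>\<delta>\<close>. Every cut-off is thereby reduced to \<open>\<delta> = 1\<close>.\<close>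

lemma heat_tail_scale:
  assumes "\<delta> > 0"
  shows "heat_tail \<beta> \<delta> (sqrt \<delta> * r) = \<delta> powr (- \<beta>) * heat_tail \<beta> 1 r"
proof -
  have "heat_tail \<beta> \<delta> (sqrt \<delta> * r) = \<delta> * (\<integral>t. indicator {\<delta><..} (\<delta> * t) * heat_weight \<beta> (sqrt \<delta> * r) (\<delta> * t) \<partial>lborel)"
    unfolding heat_tail_def set_lebesgue_integral_def
    using assms by (subst lborel_integral_scaleR(2)[where c = \<delta>]) auto
  also have "(\<lambda>t. indicator {\<delta><..} (\<delta> * t) * heat_weight \<beta> (sqrt \<delta> * r) (\<delta> * t))
     = (\<lambda>t. \<delta> powr (- 1 - \<beta>) * (indicator {1<..} t * heat_weight \<beta> r t))"
  proof
    fix t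
    show "indicator {\<delta><..} (\<delta> * t) * heat_weight \<beta> (sqrt \<delta> * r) (\<delta> * t)
      = \<delta> powr (- 1 - \<beta>) * (indicator {1<..} t * heat_weight \<beta> r t)"
    proof (cases "t > 1")
      case True
      then show ?thesis using assms
        by (simp add: heat_weight_def powr_mult power_mult_distrib)
    qed (use assms in auto)
  qed
  also have "\<delta> * (\<integral>t. \<delta> powr (- 1 - \<beta>) * (indicator {1<..} t * heat_weight \<beta> r t) \<partial>lborel)
     = (\<delta> powr 1 * \<delta> powr (- 1 - \<beta>)) * heat_tail \<beta> 1 r"
    using assms by (simp add: heat_tail_def set_lebesgue_integral_def)
  also have "\<delta> powr 1 * \<delta> powr (- 1 - \<beta>) = \<delta> powr (- \<beta>)"
    by (simp only: powr_add[symmetric]) simp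
  finally show ?thesis .
qed

text \<open>Compares the soft cut-off of the singular kernel with the sharp one at radius 1. For
  \<open>r \<le> 1\<close> only the soft one is present, and it is bounded; for \<open>r > 1\<close>
  the difference is the contribution of the times up to 1, where
  \<open>exp (- r\<^sup>2 / (4 * t))\<close> is already small.\<close>

lemma heat_tail_cutoff_bound:
  assumes "\<beta> > 0"
  obtains C where "C > 0"
    "\<And>r. r \<ge> 0 \<Longrightarrow> \<bar>heat_tail \<beta> 1 r - 4 powr \<beta> * Gamma \<beta> * r powr (- 2 * \<beta>) * indicator {1<..} r\<bar>
       \<le> C * exp (- (1/8) * r\<^sup>2)"
proof -
  define K where "K = (LINT t:{1<..}|lborel. t powr (- 1 - \<beta>))"
  \<comment> \<open>The radius \<open>1 / sqrt 2\<close> produces the exponent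
    \<open>- 1 / (8 * t)\<close>, which is what remains after
    \<open>exp (- (1/8) * r\<^sup>2)\<close> has been split off.\<close>
  define L where "L = heat_tail \<beta> 0 (1 / sqrt 2)"
  have K: "K \<ge> 0" unfolding K_def set_lebesgue_integral_def by (intro Bochner_Integration.integral_nonneg) auto
  have L: "L \<ge> 0" unfolding L_def by (rule heat_tail_nonneg)
  \<comment> \<open>\<open>exp (1/8)\<close> makes up for the loss of
    \<open>exp (- (1/8) * r\<^sup>2)\<close> when \<open>r \<le> 1\<close>; the 1 makes
    \<open>C\<close> positive.\<close>
  define C where "C = K * exp (1/8) + L + 1"
  have small: "\<bar>heat_tail \<beta> 1 r\<bar> \<le> C * exp (- (1/8) * r\<^sup>2)" if "0 \<le> r" "r \<le> 1" for r
  proof -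
    have "heat_tail \<beta> 1 r \<le> K"
      unfolding heat_tail_def K_def using assms
      by (intro set_integral_mono set_integrable_heat_weight_tail set_integrable_powr_to_inf heat_weight_le) auto
    also have "K * 1 \<le> K * (exp (1/8) * exp (- (1/8) * r\<^sup>2))"
      using K that by (intro mult_left_mono) (auto simp: power_le_one simp flip: exp_add)
    also have "\<dots> \<le> C * exp (- (1/8) * r\<^sup>2)"
      unfolding mult.assoc[symmetric] C_def using L by (intro mult_right_mono) auto
    finally show ?thesis using heat_tail_nonneg[of \<beta> 1 r] by simp
  qed
  have large: "\<bar>heat_tail \<beta> 1 r - 4 powr \<beta> * Gamma \<beta> * r powr (- 2 * \<beta>)\<bar> \<le> C * exp (- (1/8) * r\<^sup>2)"
    if "r > 1" for r
  proof -
    have si: "set_integrable lborel {0<..} (heat_weight \<beta> r)"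
      using that assms by (intro set_integrable_heat_weight) auto
    have split: "heat_tail \<beta> 0 r = (LINT t:{0<..1}|lborel. heat_weight \<beta> r t) + heat_tail \<beta> 1 r"
    proof -
      have eq: "{0<..} = {0<..1} \<union> {1::real<..}" by auto
      show ?thesis unfolding heat_tail_def eq
        by (rule set_integral_Un) (auto intro!: set_integrable_subset[OF si])
    qed
    have "(LINT t:{0<..1}|lborel. heat_weight \<beta> r t)
       \<le> (LINT t:{0<..1}|lborel. exp (- (1/8) * r\<^sup>2) * heat_weight \<beta> (1 / sqrt 2) t)"
    proof (rule set_integral_mono)
      show "set_integrable lborel {0<..1} (heat_weight \<beta> r)"
        by (auto intro!: set_integrable_subset[OF si])
      show "set_integrable lborel {0<..1} (\<lambda>t. exp (- (1/8) * r\<^sup>2) * heat_weight \<beta> (1 / sqrt 2) t)"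
        by (intro set_integrable_mult_right set_integrable_subset[OF set_integrable_heat_weight]) (use assms in auto)
      fix t :: real assume t: "t \<in> {0<..1}"
      \<comment> \<open>Divided by \<open>8 * t\<close> this says
        \<open>r\<^sup>2 / 8 + 1 / (8 * t) \<le> r\<^sup>2 / (4 * t)\<close>.\<close>
      have "r\<^sup>2 * t + 1 \<le> r\<^sup>2 + r\<^sup>2"
        using t that mult_left_le[of t "r\<^sup>2"] power_mono[of 1 r 2] by (intro add_mono) auto
      then have "- r\<^sup>2 / (4 * t) \<le> - (1/8) * r\<^sup>2 - (1 / sqrt 2)\<^sup>2 / (4 * t)"
        using t by (simp add: field_simps power_divide)
      then have E: "exp (- r\<^sup>2 / (4 * t)) \<le> exp (- (1/8) * r\<^sup>2) * exp (- (1 / sqrt 2)\<^sup>2 / (4 * t))"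
        by (simp flip: exp_add)
      show "heat_weight \<beta> r t \<le> exp (- (1/8) * r\<^sup>2) * heat_weight \<beta> (1 / sqrt 2) t"
        unfolding heat_weight_def by (subst mult.left_commute, rule mult_left_mono[OF E]) simp
    qed
    also have "\<dots> = exp (- (1/8) * r\<^sup>2) * (LINT t:{0<..1}|lborel. heat_weight \<beta> (1 / sqrt 2) t)"
      by simp
    also have "(LINT t:{0<..1}|lborel. heat_weight \<beta> (1 / sqrt 2) t) \<le> L"
      unfolding L_def heat_tail_def set_lebesgue_integral_def
    proof (rule integral_mono)
      have si: "set_integrable lborel {0<..} (heat_weight \<beta> (1 / sqrt 2))"
        using assms by (intro set_integrable_heat_weight) auto
      then show "integrable lborel (\<lambda>t. indicator {0<..} t *\<^sub>R heat_weight \<beta> (1 / sqrt 2) t)"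
        by (simp add: set_integrable_def)
      have "set_integrable lborel {0<..1} (heat_weight \<beta> (1 / sqrt 2))"
        by (rule set_integrable_subset[OF si]) auto
      then show "integrable lborel (\<lambda>t. indicator {0<..1} t *\<^sub>R heat_weight \<beta> (1 / sqrt 2) t)"
        by (simp add: set_integrable_def)
    qed (auto split: split_indicator)
    also have "L \<le> C" using K by (simp add: C_def)
    finally have "(LINT t:{0<..1}|lborel. heat_weight \<beta> r t) \<le> C * exp (- (1/8) * r\<^sup>2)"
      by (simp add: mult_ac)
    moreover have "0 \<le> (LINT t:{0<..1}|lborel. heat_weight \<beta> r t)"
      unfolding set_lebesgue_integral_def by (intro Bochner_Integration.integral_nonneg) auto
    ultimately show ?thesis
      using split heat_tail_0[OF assms, of r] that by simp
  qed
  show thesis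
  proof
    show "C > 0" using K L by (simp add: C_def add_nonneg_pos)
    fix r :: real assume "r \<ge> 0"
    then show "\<bar>heat_tail \<beta> 1 r - 4 powr \<beta> * Gamma \<beta> * r powr (- 2 * \<beta>) * indicator {1<..} r\<bar>
       \<le> C * exp (- (1/8) * r\<^sup>2)"
      using small[of r] large[of r] by (cases "r > 1") auto
  qed
qed

section \<open>Exchanging the integrals over time and space\<close>

text \<open>After \<open>z = sqrt t w\<close> the Gaussian no longer depends on \<open>t\<close>;
  the Jacobian gives \<open>t powr (n / 2)\<close> and homogeneity
  \<open>t powr (\<gamma> / 2)\<close>. Negative values of \<open>h\<close> are cut off by
  \<open>ennreal\<close> on both sides alike.\<close>

lemma nn_integral_homogeneous_heat:
  fixes h :: "'a::euclidean_space \<Rightarrow> real"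
  assumes [measurable]: "h \<in> borel_measurable borel"
    and hom: "\<And>c z. c > 0 \<Longrightarrow> h (c *\<^sub>R z) = c powr \<gamma> * h z"
    and "t > 0"
  shows "(\<integral>\<^sup>+z. ennreal (h z * heat_weight \<beta> (norm z) t) \<partial>lborel) =
    ennreal (t powr (- 1 - \<beta> + (real DIM('a) + \<gamma>) / 2)) * (\<integral>\<^sup>+z. ennreal (h z * exp (- (1/4) * (norm z)\<^sup>2)) \<partial>lborel)"
proof -
  have "sqrt t ^ DIM('a) = t powr (DIM('a) / 2)"
    using \<open>t > 0\<close> by (simp add: powr_half_sqrt[symmetric] powr_power)
  then have const: "sqrt t ^ DIM('a) * (t powr (\<gamma> / 2) * t powr (- 1 - \<beta>)) = t powr (- 1 - \<beta> + (real DIM('a) + \<gamma>) / 2)"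
    by (simp add: powr_add[symmetric] add_divide_distrib algebra_simps)
  have "(\<integral>\<^sup>+z. ennreal (h z * heat_weight \<beta> (norm z) t) \<partial>lborel) =
      ennreal (\<bar>sqrt t\<bar> ^ DIM('a)) * (\<integral>\<^sup>+z. ennreal (h (sqrt t *\<^sub>R z) * heat_weight \<beta> (norm (sqrt t *\<^sub>R z)) t) \<partial>lborel)"
    using \<open>t > 0\<close> by (intro nn_integral_lborel_scaleR) auto
  also have "(\<lambda>z. ennreal (h (sqrt t *\<^sub>R z) * heat_weight \<beta> (norm (sqrt t *\<^sub>R z)) t)) =
     (\<lambda>z. ennreal (t powr (\<gamma> / 2) * t powr (- 1 - \<beta>)) * ennreal (h z * exp (- (1/4) * (norm z)\<^sup>2)))"
  proof
    fix z
    have "sqrt t powr \<gamma> = t powr (\<gamma> / 2)"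
      using \<open>t > 0\<close> by (simp add: powr_half_sqrt[symmetric] powr_powr)
    then have "h (sqrt t *\<^sub>R z) * heat_weight \<beta> (norm (sqrt t *\<^sub>R z)) t =
       (t powr (\<gamma> / 2) * t powr (- 1 - \<beta>)) * (h z * exp (- (1/4) * (norm z)\<^sup>2))"
      using \<open>t > 0\<close> by (simp add: hom heat_weight_def power_mult_distrib)
    then show "ennreal (h (sqrt t *\<^sub>R z) * heat_weight \<beta> (norm (sqrt t *\<^sub>R z)) t) =
       ennreal (t powr (\<gamma> / 2) * t powr (- 1 - \<beta>)) * ennreal (h z * exp (- (1/4) * (norm z)\<^sup>2))"
      by (simp add: ennreal_mult')
  qed
  also have "(\<integral>\<^sup>+z. ennreal (t powr (\<gamma> / 2) * t powr (- 1 - \<beta>)) * ennreal (h z * exp (- (1/4) * (norm z)\<^sup>2)) \<partial>lborel)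
     = ennreal (t powr (\<gamma> / 2) * t powr (- 1 - \<beta>)) * (\<integral>\<^sup>+z. ennreal (h z * exp (- (1/4) * (norm z)\<^sup>2)) \<partial>lborel)"
    by (rule nn_integral_cmult) measurable
  finally show ?thesis
    using \<open>t > 0\<close> const by (simp add: mult.assoc[symmetric] ennreal_mult'[symmetric])
qed

text \<open>\<open>fin\<close> is absolute integrability over time and space together, so Fubini
  gives all three claims; \<open>heat_tail\<close> is what remains when time is integrated
  first.\<close>

lemma heat_fubini:
  fixes f :: "'a::euclidean_space \<Rightarrow> real"
  assumes [measurable]: "f \<in> borel_measurable borel"
    and fin: "(\<integral>\<^sup>+t\<in>{\<delta><..}. (\<integral>\<^sup>+z. ennreal (\<bar>f z\<bar> * heat_weight \<beta> (norm z) t) \<partial>lborel) \<partial>lborel) < \<infinity>"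
  shows "integrable lborel (\<lambda>z. f z * heat_tail \<beta> \<delta> (norm z))"
    and "set_integrable lborel {\<delta><..} (\<lambda>t. \<integral>z. f z * heat_weight \<beta> (norm z) t \<partial>lborel)"
    and "(LINT t:{\<delta><..}|lborel. \<integral>z. f z * heat_weight \<beta> (norm z) t \<partial>lborel) =
         (\<integral>z. f z * heat_tail \<beta> \<delta> (norm z) \<partial>lborel)"
proof -
  define G where "G t z = indicator {\<delta><..} t * (f z * heat_weight \<beta> (norm z) t)" for t z
  have [measurable]: "case_prod G \<in> borel_measurable (lborel \<Otimes>\<^sub>M lborel)"
    unfolding G_def by measurable
  have G: "integrable (lborel \<Otimes>\<^sub>M lborel) (case_prod G)"
  proof (rule integrableI_bounded)
    have "(\<integral>\<^sup>+x. ennreal (norm (case_prod G x)) \<partial>(lborel \<Otimes>\<^sub>M lborel)) =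
      (\<integral>\<^sup>+t. (\<integral>\<^sup>+z. ennreal (norm (G t z)) \<partial>lborel) \<partial>lborel)"
      by (subst lborel.nn_integral_fst[symmetric]) auto
    also have "\<dots> = (\<integral>\<^sup>+t\<in>{\<delta><..}. (\<integral>\<^sup>+z. ennreal (\<bar>f z\<bar> * heat_weight \<beta> (norm z) t) \<partial>lborel) \<partial>lborel)"
      by (intro nn_integral_cong) (auto simp: G_def abs_mult split: split_indicator)
    finally show "(\<integral>\<^sup>+x. ennreal (norm (case_prod G x)) \<partial>(lborel \<Otimes>\<^sub>M lborel)) < \<infinity>"
      using fin by simp
  qed measurable
  have t: "(\<integral>t. G t z \<partial>lborel) = f z * heat_tail \<beta> \<delta> (norm z)" for z
  proof -
    have "(\<integral>t. G t z \<partial>lborel) = (\<integral>t. f z * (indicator {\<delta><..} t * heat_weight \<beta> (norm z) t) \<partial>lborel)"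
      by (simp add: G_def mult_ac)
    then show ?thesis by (simp add: heat_tail_def set_lebesgue_integral_def)
  qed
  have z: "(\<integral>z. G t z \<partial>lborel) = indicator {\<delta><..} t *\<^sub>R (\<integral>z. f z * heat_weight \<beta> (norm z) t \<partial>lborel)" for t
    by (simp add: G_def)
  show "integrable lborel (\<lambda>z. f z * heat_tail \<beta> \<delta> (norm z))"
    using lborel_pair.integrable_snd[OF G] by (simp add: t)
  show "set_integrable lborel {\<delta><..} (\<lambda>t. \<integral>z. f z * heat_weight \<beta> (norm z) t \<partial>lborel)"
    using lborel_pair.integrable_fst[OF G] by (simp add: z set_integrable_def)
  show "(LINT t:{\<delta><..}|lborel. \<integral>z. f z * heat_weight \<beta> (norm z) t \<partial>lborel) =
         (\<integral>z. f z * heat_tail \<beta> \<delta> (norm z) \<partial>lborel)"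
    using lborel_pair.Fubini_integral[OF G] by (simp add: t z set_lebesgue_integral_def)
qed

text \<open>A constant majorant is homogeneous of degree 0; it leaves a power of \<open>t\<close>
  that is integrable at infinity once \<open>\<alpha> > 0\<close>.\<close>

lemma heat_nn_integral_bounded:
  fixes f :: "'a::euclidean_space \<Rightarrow> real"
  assumes [measurable]: "f \<in> borel_measurable borel"
    and bnd: "\<And>z. \<bar>f z\<bar> \<le> B" and "t > 0"
  shows "(\<integral>\<^sup>+z. ennreal (\<bar>f z\<bar> * heat_weight ((real DIM('a) + \<alpha>) / 2) (norm z) t) \<partial>lborel)
     \<le> ennreal (t powr (- 1 - \<alpha> / 2)) * (ennreal B * (\<integral>\<^sup>+z. ennreal (exp (- (1/4) * (norm (z::'a))\<^sup>2)) \<partial>lborel))"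
proof -
  have B: "B \<ge> 0" using bnd[of 0] by linarith
  have "(\<integral>\<^sup>+z. ennreal (\<bar>f z\<bar> * heat_weight ((real DIM('a) + \<alpha>) / 2) (norm z) t) \<partial>lborel)
     \<le> (\<integral>\<^sup>+z. ennreal (B * heat_weight ((real DIM('a) + \<alpha>) / 2) (norm (z::'a)) t) \<partial>lborel)"
    using bnd by (intro nn_integral_mono ennreal_leI mult_right_mono) auto
  also have "\<dots> = ennreal (t powr (- 1 - \<alpha> / 2)) * (\<integral>\<^sup>+z. ennreal (B * exp (- (1/4) * (norm (z::'a))\<^sup>2)) \<partial>lborel)"
    using nn_integral_homogeneous_heat[of "\<lambda>_::'a. B" 0 t "(real DIM('a) + \<alpha>) / 2"] \<open>t > 0\<close>
    by (simp add: add_divide_distrib)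
  also have "(\<integral>\<^sup>+z. ennreal (B * exp (- (1/4) * (norm (z::'a))\<^sup>2)) \<partial>lborel) =
      ennreal B * (\<integral>\<^sup>+z. ennreal (exp (- (1/4) * (norm (z::'a))\<^sup>2)) \<partial>lborel)"
    by (subst nn_integral_cmult[symmetric]) (auto simp: ennreal_mult' B)
  finally show ?thesis .
qed

lemma gaussian_nn_integral_finite:
  "c > 0 \<Longrightarrow> (\<integral>\<^sup>+z. ennreal (exp (- c * (norm (z::'a::euclidean_space))\<^sup>2)) \<partial>lborel) < \<infinity>"
  using integrable_gaussian[of c, where 'a = 'a] by (subst nn_integral_eq_integral) auto

lemma heat_finite_bounded:
  fixes f :: "'a::euclidean_space \<Rightarrow> real"
  assumes [measurable]: "f \<in> borel_measurable borel"
    and bnd: "\<And>z. \<bar>f z\<bar> \<le> B" and "\<delta> > 0" "\<alpha> > 0"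
  shows "(\<integral>\<^sup>+t\<in>{\<delta><..}. (\<integral>\<^sup>+z. ennreal (\<bar>f z\<bar> * heat_weight ((real DIM('a) + \<alpha>) / 2) (norm z) t) \<partial>lborel) \<partial>lborel) < \<infinity>"
proof -
  define I where "I = ennreal B * (\<integral>\<^sup>+z. ennreal (exp (- (1/4) * (norm (z::'a))\<^sup>2)) \<partial>lborel)"
  have I: "I < \<infinity>"
    using gaussian_nn_integral_finite[of "1/4", where 'a = 'a] by (simp add: I_def ennreal_mult_less_top)
  have "(\<integral>\<^sup>+t\<in>{\<delta><..}. (\<integral>\<^sup>+z. ennreal (\<bar>f z\<bar> * heat_weight ((real DIM('a) + \<alpha>) / 2) (norm z) t) \<partial>lborel) \<partial>lborel)
     \<le> (\<integral>\<^sup>+t. (ennreal (t powr (- 1 - \<alpha> / 2)) * indicator {\<delta><..} t) * I \<partial>lborel)"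
    using heat_nn_integral_bounded[OF assms(1) bnd] \<open>\<delta> > 0\<close>
    by (intro nn_integral_mono) (auto simp: I_def split: split_indicator)
  also have "\<dots> = (\<integral>\<^sup>+t\<in>{\<delta><..}. ennreal (t powr (- 1 - \<alpha> / 2)) \<partial>lborel) * I"
    by (rule nn_integral_multc) measurable
  also have "\<dots> < \<infinity>"
    using I nn_integral_powr_to_inf_finite[of \<delta> "\<alpha>/2"] assms by (simp add: ennreal_mult_less_top)
  finally show ?thesis .
qed

text \<open>Two majorants for two ranges of time: \<open>h\<close> settles small times because
  \<open>\<gamma> > \<alpha>\<close>, the bound \<open>B\<close> settles large times because
  \<open>\<alpha> > 0\<close>. The comparison is almost everywhere because a negative power of a
  linear form takes the value \<open>0 powr a = 0\<close> on its zero hyperplane and is no majorant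
  there.\<close>

lemma heat_finite_homogeneous:
  fixes f h :: "'a::euclidean_space \<Rightarrow> real"
  assumes [measurable]: "f \<in> borel_measurable borel" "h \<in> borel_measurable borel"
    and bnd: "\<And>z. \<bar>f z\<bar> \<le> B" and "\<alpha> > 0" "\<gamma> > \<alpha>"
    and hom: "\<And>c z. c > 0 \<Longrightarrow> h (c *\<^sub>R z) = c powr \<gamma> * h z"
    and le: "AE z in lborel. \<bar>f z\<bar> \<le> h z"
    and int: "integrable lborel (\<lambda>z. h z * exp (- (1/4) * (norm z)\<^sup>2))"
  shows "(\<integral>\<^sup>+t\<in>{0<..}. (\<integral>\<^sup>+z. ennreal (\<bar>f z\<bar> * heat_weight ((real DIM('a) + \<alpha>) / 2) (norm z) t) \<partial>lborel) \<partial>lborel) < \<infinity>"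
proof -
  let ?\<beta> = "(real DIM('a) + \<alpha>) / 2"
  let ?\<Psi> = "\<lambda>t. (\<integral>\<^sup>+z. ennreal (\<bar>f z\<bar> * heat_weight ?\<beta> (norm z) t) \<partial>lborel)"
  define I where "I = (\<integral>\<^sup>+z. ennreal (h z * exp (- (1/4) * (norm z)\<^sup>2)) \<partial>lborel)"
  have "I \<le> (\<integral>\<^sup>+z. ennreal (norm (h z * exp (- (1/4) * (norm z)\<^sup>2))) \<partial>lborel)"
    unfolding I_def by (intro nn_integral_mono ennreal_leI) auto
  also have "\<dots> < \<infinity>" using int by (simp add: integrable_iff_bounded)
  finally have I: "I < \<infinity>" .
  have small: "?\<Psi> t \<le> ennreal (t powr ((\<gamma> - \<alpha>) / 2 - 1)) * I" if "t > 0" for t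
  proof -
    have "?\<Psi> t \<le> (\<integral>\<^sup>+z. ennreal (h z * heat_weight ?\<beta> (norm z) t) \<partial>lborel)"
      using le by (intro nn_integral_mono_AE) (auto intro!: ennreal_leI mult_right_mono)
    also have "\<dots> = ennreal (t powr (- 1 - ?\<beta> + (real DIM('a) + \<gamma>) / 2)) * I"
      unfolding I_def by (rule nn_integral_homogeneous_heat) (use hom that in auto)
    also have "- 1 - ?\<beta> + (real DIM('a) + \<gamma>) / 2 = (\<gamma> - \<alpha>) / 2 - 1"
      by (simp add: field_simps)
    finally show ?thesis .
  qed
  have *: "(\<integral>\<^sup>+t\<in>{0..1}. ennreal (t powr ((\<gamma> - \<alpha>) / 2 - 1)) \<partial>lborel) < \<infinity>"
  proof -
    have "(\<integral>\<^sup>+t\<in>{0..1}. ennreal (t powr ((\<gamma> - \<alpha>) / 2 - 1)) \<partial>lborel) = ennreal (1 powr ((\<gamma> - \<alpha>) / 2 - 1 + 1) / ((\<gamma> - \<alpha>) / 2 - 1 + 1))"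
      using assms by (intro nn_integral_has_integral_lebesgue' has_integral_powr_from_0) auto
    then show ?thesis by simp
  qed
  have "(\<integral>\<^sup>+t\<in>{0<..}. ?\<Psi> t \<partial>lborel)
     \<le> (\<integral>\<^sup>+t. (ennreal (t powr ((\<gamma> - \<alpha>) / 2 - 1)) * indicator {0..1} t) * I + ?\<Psi> t * indicator {1<..} t \<partial>lborel)"
    using small by (intro nn_integral_mono) (auto split: split_indicator)
  also have "\<dots> = (\<integral>\<^sup>+t\<in>{0..1}. ennreal (t powr ((\<gamma> - \<alpha>) / 2 - 1)) \<partial>lborel) * I + (\<integral>\<^sup>+t\<in>{1<..}. ?\<Psi> t \<partial>lborel)"
    by (subst nn_integral_add) (auto simp: nn_integral_multc)
  also have "\<dots> < \<infinity>"
    using I * heat_finite_bounded[OF assms(1) bnd, of 1 \<alpha>] \<open>\<alpha> > 0\<close> by (simp add: ennreal_mult_less_top)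
  finally show ?thesis .
qed

lemma heat_fubini_0:
  fixes f :: "'a::euclidean_space \<Rightarrow> real"
  assumes [measurable]: "f \<in> borel_measurable borel" and "\<alpha> > 0"
  defines "\<beta> \<equiv> (real DIM('a) + \<alpha>) / 2"
  assumes fin: "(\<integral>\<^sup>+t\<in>{0<..}. (\<integral>\<^sup>+z. ennreal (\<bar>f z\<bar> * heat_weight \<beta> (norm z) t) \<partial>lborel) \<partial>lborel) < \<infinity>"
  shows "integrable lborel (\<lambda>z. f z / norm z powr (real DIM('a) + \<alpha>))"
    and "set_integrable lborel {0<..} (\<lambda>t. \<integral>z. f z * heat_weight \<beta> (norm z) t \<partial>lborel)"
    and "(LINT t:{0<..}|lborel. \<integral>z. f z * heat_weight \<beta> (norm z) t \<partial>lborel) =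
         4 powr \<beta> * Gamma \<beta> * (\<integral>z. f z / norm z powr (real DIM('a) + \<alpha>) \<partial>lborel)"
proof -
  have \<beta>: "\<beta> > 0" using \<open>\<alpha> > 0\<close> unfolding \<beta>_def by (intro divide_pos_pos add_nonneg_pos) auto
  define A where "A = 4 powr \<beta> * Gamma \<beta>"
  have A: "A > 0" using \<beta> by (simp add: A_def Gamma_real_pos)
  note hf = heat_fubini[OF assms(1) fin]
  \<comment> \<open>The closed form of \<open>heat_tail\<close> is for positive radius; the origin
    is a null set.\<close>
  have AE0: "AE z::'a in lborel. z \<noteq> 0" by (rule AE_lborel_singleton)
  have eq: "f z * heat_tail \<beta> 0 (norm z) = A * (f z / norm z powr (real DIM('a) + \<alpha>))" if "z \<noteq> 0" for z
  proof -
    have e: "- 2 * \<beta> = - (real DIM('a) + \<alpha>)" by (simp add: \<beta>_def)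
    have "heat_tail \<beta> 0 (norm z) = A * norm z powr (- (real DIM('a) + \<alpha>))"
      unfolding A_def e[symmetric] by (rule heat_tail_0[OF \<beta>]) (use that in simp)
    also have "norm z powr (- (real DIM('a) + \<alpha>)) = 1 / norm z powr (real DIM('a) + \<alpha>)"
      by (rule powr_minus_divide)
    finally show ?thesis by simp
  qed
  have "integrable lborel (\<lambda>z. A * (f z / norm z powr (real DIM('a) + \<alpha>)))"
    using hf(1) AE0 eq by (subst integrable_cong_AE[where g = "\<lambda>z. f z * heat_tail \<beta> 0 (norm z)"]) auto
  then have "integrable lborel (\<lambda>z. 1 / A * (A * (f z / norm z powr (real DIM('a) + \<alpha>))))"
    by (rule integrable_mult_right)
  then show "integrable lborel (\<lambda>z. f z / norm z powr (real DIM('a) + \<alpha>))"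
    using A by simp
  show "set_integrable lborel {0<..} (\<lambda>t. \<integral>z. f z * heat_weight \<beta> (norm z) t \<partial>lborel)" by (fact hf)
  have "(\<integral>z. f z * heat_tail \<beta> 0 (norm z) \<partial>lborel) = (\<integral>z. A * (f z / norm z powr (real DIM('a) + \<alpha>)) \<partial>lborel)"
    using hf(1) AE0 eq by (intro integral_cong_AE) auto
  also have "\<dots> = A * (\<integral>z. f z / norm z powr (real DIM('a) + \<alpha>) \<partial>lborel)"
    by (rule integral_mult_right_zero)
  finally show "(LINT t:{0<..}|lborel. \<integral>z. f z * heat_weight \<beta> (norm z) t \<partial>lborel) =
         4 powr \<beta> * Gamma \<beta> * (\<integral>z. f z / norm z powr (real DIM('a) + \<alpha>) \<partial>lborel)"
    using hf(3) by (simp add: A_def)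
qed

text \<open>The indicator lies below \<open>(norm z / \<epsilon>) powr (\<alpha> + 1)\<close>, whose
  degree exceeds \<open>\<alpha>\<close>, so the heat criterion yields integrability without polar
  coordinates.\<close>

lemma integrable_powr_outside_ball:
  assumes "\<alpha> > 0" "\<epsilon> > 0"
  shows "integrable lborel (\<lambda>z::'a::euclidean_space. indicator {z. norm z > \<epsilon>} z / norm z powr (real DIM('a) + \<alpha>))"
proof (rule heat_fubini_0(1)[OF _ \<open>\<alpha> > 0\<close>])
  let ?h = "\<lambda>z::'a. \<epsilon> powr (- (\<alpha> + 1)) * norm z powr (\<alpha> + 1)"
  show "(\<integral>\<^sup>+t\<in>{0<..}. (\<integral>\<^sup>+z. ennreal (\<bar>indicator {z::'a. norm z > \<epsilon>} z\<bar> * heat_weight ((real DIM('a) + \<alpha>) / 2) (norm z) t) \<partial>lborel) \<partial>lborel) < \<infinity>"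
  proof (rule heat_finite_homogeneous[where h = ?h and B = 1 and \<gamma> = "\<alpha> + 1"])
    show "AE z in lborel. \<bar>indicat_real {z. norm z > \<epsilon>} z\<bar> \<le> ?h z"
    proof (intro AE_I2)
      fix z :: 'a
      have "1 \<le> ?h z" if "norm z > \<epsilon>"
      proof -
        have "\<epsilon> powr (\<alpha> + 1) \<le> norm z powr (\<alpha> + 1)"
          using that assms by (intro powr_mono2) auto
        then show ?thesis using assms by (simp only: powr_minus_divide) (simp add: field_simps)
      qed
      then show "\<bar>indicat_real {z. norm z > \<epsilon>} z\<bar> \<le> ?h z" by (auto split: split_indicator)
    qed
    show "integrable lborel (\<lambda>z. ?h z * exp (- (1/4) * (norm z)\<^sup>2))"
      using assms integrable_powr_gaussian[of "1/4" "\<alpha> + 1", where 'a = 'a]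
      unfolding mult.assoc by (intro integrable_mult_right) auto
  qed (use assms in \<open>auto simp: powr_mult split: split_indicator\<close>)
qed measurable

lemma integral_even_part:
  fixes F :: "'a::euclidean_space \<Rightarrow> real"
  assumes "integrable lborel F"
  shows "(\<integral>z. (F z + F (- z)) / 2 \<partial>lborel) = (\<integral>z. F z \<partial>lborel)"
proof -
  have [measurable]: "F \<in> borel_measurable borel" using assms by auto
  have "integrable lborel (\<lambda>z. F (- z))" "(\<integral>z. F (- z) \<partial>lborel) = (\<integral>z. F z \<partial>lborel)"
    using assms lborel_integral_scaleR[of F "-1"] by simp_all
  then show ?thesis using assms by simp
qed

subsection \<open>Radial integrals of homogeneous functions\<close>

lemma nn_integral_powr_ball_pos:
  "(\<integral>\<^sup>+w. ennreal (norm (w::'a::euclidean_space) powr \<gamma>) * indicator {w. norm w < 1} w \<partial>lborel) \<noteq> 0"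
proof
  assume "(\<integral>\<^sup>+w. ennreal (norm (w::'a) powr \<gamma>) * indicator {w. norm w < 1} w \<partial>lborel) = 0"
  then have "AE w::'a in lborel. ennreal (norm w powr \<gamma>) * indicator {w. norm w < 1} w = 0"
    by (subst (asm) nn_integral_0_iff_AE) auto
  moreover have "AE w::'a in lborel. w \<noteq> 0" by (rule AE_lborel_singleton)
  ultimately have "AE w::'a in lborel. w \<notin> ball 0 1"
    by eventually_elim (auto split: split_indicator_asm)
  then have "ball (0::'a) 1 \<in> null_sets lborel"
    by (subst (asm) AE_iff_null_sets[symmetric]) auto
  then have "negligible (ball (0::'a) 1)"
    by (simp add: negligible_iff_null_sets null_sets_completionI)
  then show False by (auto simp: negligible_iff_measure dest: open_not_negligible[rotated])
qed

text \<open>Polar coordinates without spherical measure: the law of the norm under a homogeneous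
  density depends on the density only through a constant factor.\<close>

lemma radial_integral_homogeneous_nonneg:
  fixes h :: "'a::euclidean_space \<Rightarrow> real"
  assumes [measurable]: "h \<in> borel_measurable borel"
    and hom: "\<And>c z. c > 0 \<Longrightarrow> h (c *\<^sub>R z) = c powr \<gamma> * h z"
    and nonneg: "\<And>z. 0 \<le> h z" and le: "\<And>z. h z \<le> M * norm z powr \<gamma>" and "\<gamma> \<ge> 0"
  obtains \<kappa> :: real where "\<And>F :: real \<Rightarrow> real. F \<in> borel_measurable borel \<Longrightarrow>
    (\<integral>w. F (norm w) * h w \<partial>lborel) = \<kappa> * (\<integral>w. F (norm (w::'a)) * norm w powr \<gamma> \<partial>lborel)"
proof -
  define mass where "mass g = (\<integral>\<^sup>+w. ennreal (g w) * indicator {w. norm w < 1} w \<partial>lborel)" for g :: "'a \<Rightarrow> real"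
  \<comment> \<open>The sign turns the half-lines \<open>{x<..}\<close>, on which measures on the
    line are compared, into balls. These have finite mass, which the complements of balls need not
    have.\<close>
  define N where "N g = distr (density lborel (\<lambda>w. ennreal (g w))) borel (\<lambda>w::'a. - norm w)" for g
  let ?r = "\<lambda>w::'a. norm w powr \<gamma>"
  have finite_mass: "mass g < \<infinity>" if "\<And>z. g z \<le> K * norm z powr \<gamma>" "K \<ge> 0" for g K
  proof -
    have "mass g \<le> (\<integral>\<^sup>+w. ennreal K * indicator (ball (0::'a) 1) w \<partial>lborel)"
      unfolding mass_def
    proof (intro nn_integral_mono)
      fix w :: 'a
      have "g w \<le> K" if "norm w < 1"
      proof -
        have "K * norm w powr \<gamma> \<le> K * 1"
          using that \<open>\<gamma> \<ge> 0\<close> \<open>K \<ge> 0\<close> by (intro mult_left_mono powr_le1) auto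
        then show ?thesis using \<open>g w \<le> K * norm w powr \<gamma>\<close> by simp
      qed
      then show "ennreal (g w) * indicator {w. norm w < 1} w \<le> ennreal K * indicator (ball 0 1) w"
        by (auto simp: ennreal_leI split: split_indicator)
    qed
    also have "\<dots> = ennreal K * emeasure lborel (ball (0::'a) 1)"
      by (rule nn_integral_cmult_indicator) simp
    also have "\<dots> < \<infinity>"
      using emeasure_lborel_ball_finite[of "0::'a" 1] by (simp add: ennreal_mult_less_top)
    finally show ?thesis .
  qed
  \<comment> \<open>A ball of radius \<open>R\<close> has \<open>R powr (n + \<gamma>)\<close> times
    the mass of the unit ball, so the law depends on \<open>g\<close> through this one number
    only.\<close>
  have N_Ioi: "emeasure (N g) {x<..} = (if x < 0 then ennreal ((- x) powr (real DIM('a) + \<gamma>)) * mass g else 0)"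
    if [measurable]: "g \<in> borel_measurable borel"
      and hg: "\<And>c z. c > 0 \<Longrightarrow> g (c *\<^sub>R z) = c powr \<gamma> * g z" for g x
  proof -
    have "(\<lambda>w. - norm w) -` {x<..} = {w::'a. norm w < - x}" by auto
    then have "emeasure (N g) {x<..} = emeasure (density lborel (\<lambda>w. ennreal (g w))) {w. norm w < - x}"
      unfolding N_def by (subst emeasure_distr) auto
    also have "\<dots> = (\<integral>\<^sup>+w. ennreal (g w) * indicator {w. norm w < - x} w \<partial>lborel)"
      by (rule emeasure_density) measurable
    also have "\<dots> = (if x < 0 then ennreal ((- x) powr (real DIM('a) + \<gamma>)) * mass g else 0)"
    proof (cases "x < 0")
      case True
      define R where "R = - x"
      have R: "R > 0" using True by (simp add: R_def)
      have "(\<integral>\<^sup>+w. ennreal (g w) * indicator {w. norm w < R} w \<partial>lborel)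
        = ennreal (\<bar>R\<bar> ^ DIM('a)) * (\<integral>\<^sup>+w. ennreal (g (R *\<^sub>R w)) * indicator {w. norm w < R} (R *\<^sub>R w) \<partial>lborel)"
        using R by (intro nn_integral_lborel_scaleR) auto
      also have "(\<lambda>w. ennreal (g (R *\<^sub>R w)) * indicator {w. norm w < R} (R *\<^sub>R w)) =
         (\<lambda>w. ennreal (R powr \<gamma>) * (ennreal (g w) * indicator {w. norm w < 1} w))"
        using R by (auto simp: hg ennreal_mult' mult.assoc split: split_indicator)
      also have "(\<integral>\<^sup>+w. ennreal (R powr \<gamma>) * (ennreal (g w) * indicator {w. norm w < 1} w) \<partial>lborel) =
         ennreal (R powr \<gamma>) * mass g"
        unfolding mass_def by (rule nn_integral_cmult) measurable
      also have "ennreal (\<bar>R\<bar> ^ DIM('a)) * (ennreal (R powr \<gamma>) * mass g) = ennreal (R powr (real DIM('a) + \<gamma>)) * mass g"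
        using R by (simp add: powr_add powr_realpow ennreal_mult' mult.assoc)
      finally show ?thesis using True by (simp add: R_def)
    next
      case False
      then have "{w::'a. norm w < - x} = {}"
        by (auto simp: not_less intro: order.trans[OF _ norm_ge_zero])
      then show ?thesis using False by simp
    qed
    finally show ?thesis .
  qed
  have M: "M \<ge> 0"
  proof -
    obtain b :: 'a where "b \<in> Basis" using nonempty_Basis by blast
    then show ?thesis using nonneg[of b] le[of b] by simp
  qed
  have mh: "mass h < \<infinity>" using finite_mass[of h M] le M by simp
  have mr: "mass ?r < \<infinity>" using finite_mass[of ?r 1] by simp
  have mr0: "mass ?r \<noteq> 0" unfolding mass_def by (rule nn_integral_powr_ball_pos)
  define \<kappa> where "\<kappa> = enn2real (mass h) / enn2real (mass ?r)"
  have \<kappa>: "\<kappa> \<ge> 0" by (simp add: \<kappa>_def)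
  have "enn2real (mass ?r) > 0" using mr mr0 by (simp add: enn2real_positive_iff zero_less_iff_neq_zero)
  then have "\<kappa> * enn2real (mass ?r) = enn2real (mass h)" by (simp add: \<kappa>_def)
  then have mass_eq: "mass h = ennreal \<kappa> * mass ?r"
    using mh mr \<kappa> by (metis ennreal_enn2real ennreal_mult'' enn2real_nonneg infinity_ennreal_def)
  have mass_\<kappa>: "mass (\<lambda>w. \<kappa> * ?r w) = ennreal \<kappa> * mass ?r"
    unfolding mass_def using \<kappa>
    by (subst nn_integral_cmult[symmetric]) (auto simp: ennreal_mult' mult.assoc)
  have "N h = N (\<lambda>w. \<kappa> * ?r w)"
  proof (rule measure_eqI_lessThan)
    show "emeasure (N h) {x<..} = emeasure (N (\<lambda>w. \<kappa> * ?r w)) {x<..}" for x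
      by (subst (1 2) N_Ioi) (auto simp: hom powr_mult mass_eq mass_\<kappa>)
    show "emeasure (N h) {x<..} < \<infinity>" for x
      using mh by (subst N_Ioi) (auto simp: hom ennreal_mult_less_top)
  qed (simp_all add: N_def)
  then have eq: "(\<integral>r. F (- r) \<partial>N h) = (\<integral>r. F (- r) \<partial>N (\<lambda>w. \<kappa> * ?r w))" for F :: "real \<Rightarrow> real"
    by simp
  have int: "(\<integral>r. F (- r) \<partial>N g) = (\<integral>w. F (norm w) * g w \<partial>lborel)"
    if [measurable]: "F \<in> borel_measurable borel" "g \<in> borel_measurable borel" and "\<And>z. 0 \<le> g z"
    for F :: "real \<Rightarrow> real" and g
    unfolding N_def using that(3)
    by (subst integral_distr) (auto simp: integral_density mult.commute)
  show thesis
  proof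
    fix F :: "real \<Rightarrow> real" assume [measurable]: "F \<in> borel_measurable borel"
    have "(\<integral>w. F (norm w) * h w \<partial>lborel) = (\<integral>w. F (norm w) * (\<kappa> * ?r w) \<partial>lborel)"
      using eq[of F] nonneg \<kappa> by (simp add: int)
    also have "\<dots> = (\<integral>w. \<kappa> * (F (norm w) * ?r w) \<partial>lborel)"
      by (simp add: mult_ac)
    finally show "(\<integral>w. F (norm w) * h w \<partial>lborel) = \<kappa> * (\<integral>w. F (norm w) * ?r w \<partial>lborel)"
      by simp
  qed
qed

text \<open>Adding \<open>M * norm z powr \<gamma>\<close> makes \<open>q\<close> nonnegative and
  shifts the factor by \<open>M\<close>; integrability allows the two parts to be separated again.
  The resulting factor is the mean of \<open>q\<close> over the unit sphere.\<close>

lemma radial_integral_homogeneous: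
  fixes q :: "'a::euclidean_space \<Rightarrow> real"
  assumes [measurable]: "q \<in> borel_measurable borel"
    and hom: "\<And>c z. c > 0 \<Longrightarrow> q (c *\<^sub>R z) = c powr \<gamma> * q z"
    and le: "\<And>z. \<bar>q z\<bar> \<le> M * norm z powr \<gamma>" and "\<gamma> \<ge> 0"
  obtains \<kappa> :: real where "\<And>F :: real \<Rightarrow> real. F \<in> borel_measurable borel \<Longrightarrow>
    integrable lborel (\<lambda>w::'a. F (norm w) * norm w powr \<gamma>) \<Longrightarrow>
    (\<integral>w. F (norm w) * q w \<partial>lborel) = \<kappa> * (\<integral>w. F (norm (w::'a)) * norm w powr \<gamma> \<partial>lborel)"
proof -
  let ?h = "\<lambda>z. q z + M * norm z powr \<gamma>"
  obtain \<kappa> :: real where \<kappa>: "\<And>F :: real \<Rightarrow> real. F \<in> borel_measurable borel \<Longrightarrow>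
    (\<integral>w. F (norm w) * ?h w \<partial>lborel) = \<kappa> * (\<integral>w. F (norm (w::'a)) * norm w powr \<gamma> \<partial>lborel)"
  proof (rule radial_integral_homogeneous_nonneg[of ?h \<gamma> "2 * M"])
    show "?h (c *\<^sub>R z) = c powr \<gamma> * ?h z" if "c > 0" for c z
      using that by (simp add: hom powr_mult algebra_simps)
    show "0 \<le> ?h z" "?h z \<le> 2 * M * norm z powr \<gamma>" for z
      using le[of z] by (simp_all add: abs_le_iff)
  qed (use \<open>\<gamma> \<ge> 0\<close> in auto)
  show thesis
  proof (rule that[of "\<kappa> - M"])
    fix F :: "real \<Rightarrow> real"
    assume [measurable]: "F \<in> borel_measurable borel"
      and int: "integrable lborel (\<lambda>w::'a. F (norm w) * norm w powr \<gamma>)"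
    have "integrable lborel (\<lambda>w::'a. F (norm w) * q w)"
    proof (rule Bochner_Integration.integrable_bound[OF integrable_mult_right[OF int, of M]])
      show "AE w in lborel. norm (F (norm w) * q w) \<le> norm (M * (F (norm w) * norm w powr \<gamma>))"
      proof (intro AE_I2)
        fix w
        have "\<bar>q w\<bar> \<le> \<bar>M * norm w powr \<gamma>\<bar>" using le[of w] by simp
        then have "\<bar>F (norm w)\<bar> * \<bar>q w\<bar> \<le> \<bar>F (norm w)\<bar> * \<bar>M * norm w powr \<gamma>\<bar>" by (rule mult_left_mono) simp
        then show "norm (F (norm w) * q w) \<le> norm (M * (F (norm w) * norm w powr \<gamma>))"
          by (simp add: abs_mult mult_ac)
      qed
    qed measurable
    then have "(\<integral>w. F (norm w) * ?h w \<partial>lborel) =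
      (\<integral>w. F (norm w) * q w \<partial>lborel) + M * (\<integral>w. F (norm (w::'a)) * norm w powr \<gamma> \<partial>lborel)"
      using int by (simp add: distrib_left mult.left_commute[of _ M])
    then show "(\<integral>w. F (norm w) * q w \<partial>lborel) = (\<kappa> - M) * (\<integral>w. F (norm (w::'a)) * norm w powr \<gamma> \<partial>lborel)"
      using \<kappa>[of F] by (simp add: algebra_simps)
  qed
qed

lemma integral_dominated_convergence_at_right:
  fixes s :: "real \<Rightarrow> 'a \<Rightarrow> real"
  assumes "f \<in> borel_measurable M" "\<And>t. t > 0 \<Longrightarrow> s t \<in> borel_measurable M" "integrable M w"
    and lim: "AE x in M. ((\<lambda>t. s t x) \<longlongrightarrow> f x) (at_right 0)"
    and bound: "\<And>t. t > 0 \<Longrightarrow> AE x in M. norm (s t x) \<le> w x"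
  shows "((\<lambda>t. integral\<^sup>L M (s t)) \<longlongrightarrow> integral\<^sup>L M f) (at_right 0)"
proof (rule tendsto_at_right_sequentially[of 0 1])
  fix S :: "nat \<Rightarrow> real"
  assume S: "\<And>n. 0 < S n" "S \<longlonglongrightarrow> 0"
  have F: "filterlim S (at_right 0) sequentially"
    using S by (intro tendsto_imp_filterlim_at_right) auto
  show "(\<lambda>n. integral\<^sup>L M (s (S n))) \<longlonglongrightarrow> integral\<^sup>L M f"
  proof (rule integral_dominated_convergence[where w = w])
    show "AE x in M. (\<lambda>n. s (S n) x) \<longlonglongrightarrow> f x"
      using lim by eventually_elim (rule filterlim_compose[OF _ F])
  qed (use assms S in auto)
qed simp

subsection \<open>Truncated singular integrals and heat integrals\<close>

lemma measurable_heat_tail [measurable]: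
  assumes [measurable]: "f \<in> borel_measurable M"
  shows "(\<lambda>x. heat_tail \<beta> \<delta> (f x)) \<in> borel_measurable M"
  unfolding heat_tail_def set_lebesgue_integral_def by measurable

lemma integrable_truncated_kernel:
  fixes f :: "'a::euclidean_space \<Rightarrow> real"
  assumes [measurable]: "f \<in> borel_measurable borel"
    and bnd: "\<And>z. \<bar>f z\<bar> \<le> B" and "\<alpha> > 0" "\<epsilon> > 0"
  shows "integrable lborel (\<lambda>z. indicator {z. norm z > \<epsilon>} z * (f z / norm z powr (real DIM('a) + \<alpha>)))"
proof (rule Bochner_Integration.integrable_bound[OF integrable_mult_right[OF integrable_powr_outside_ball[OF assms(3,4)], of B]])
  show "AE z in lborel. norm (indicator {z. norm z > \<epsilon>} z * (f z / norm z powr (real DIM('a) + \<alpha>)))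
     \<le> norm (B * (indicator {z. norm z > \<epsilon>} z / norm (z::'a) powr (real DIM('a) + \<alpha>)))"
  proof (intro AE_I2)
    fix z
    have "\<bar>f z\<bar> \<le> \<bar>B\<bar>" using bnd[of z] by simp
    then show "norm (indicator {z. norm z > \<epsilon>} z * (f z / norm z powr (real DIM('a) + \<alpha>)))
     \<le> norm (B * (indicator {z. norm z > \<epsilon>} z / norm (z::'a) powr (real DIM('a) + \<alpha>)))"
      by (auto simp: abs_mult divide_right_mono split: split_indicator)
  qed
qed measurable

text \<open>Serves to conclude that a homogeneous function with vanishing Gaussian integral has
  radial factor 0.\<close>

lemma integral_powr_gaussian_pos:
  assumes "\<alpha> \<ge> 0"
  shows "(\<integral>w. exp (- (1/4) * (norm w)\<^sup>2) * norm (w::'a::euclidean_space) powr \<alpha> \<partial>lborel) \<noteq> 0"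
proof
  assume 0: "(\<integral>w. exp (- (1/4) * (norm w)\<^sup>2) * norm (w::'a) powr \<alpha> \<partial>lborel) = 0"
  have "integrable lborel (\<lambda>w. exp (- (1/4) * (norm w)\<^sup>2) * norm (w::'a) powr \<alpha>)"
    using integrable_powr_gaussian[of "1/4" \<alpha>, where 'a = 'a] assms by (simp add: mult.commute)
  from integral_nonneg_eq_0_iff_AE[OF this] 0
  have "AE w::'a in lborel. norm w powr \<alpha> = 0" by auto
  then have "(\<integral>\<^sup>+w. ennreal (norm (w::'a) powr \<alpha>) * indicator {w. norm w < 1} w \<partial>lborel) = 0"
    by (subst nn_integral_0_iff_AE) (auto elim!: eventually_mono)
  with nn_integral_powr_ball_pos show False by blast
qed

text \<open>After the scaling \<open>z = sqrt \<delta> w\<close> both sides become integrals of the rescaled function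
  against kernels that do not depend on \<open>\<delta>\<close>; their difference decays like a Gaussian, although
  each integral alone may diverge logarithmically.\<close>

lemma heat_minus_truncated_kernel:
  fixes f q :: "'a::euclidean_space \<Rightarrow> real"
  assumes [measurable]: "f \<in> borel_measurable borel" "q \<in> borel_measurable borel"
    and bnd: "\<And>z. \<bar>f z\<bar> \<le> B" and \<alpha>: "\<alpha> > 0"
    and le: "\<And>z. \<bar>f z\<bar> \<le> M * norm z powr \<alpha>"
    and leq: "\<And>z. \<bar>q z\<bar> \<le> M * norm z powr \<alpha>"
    and hom: "\<And>c z. c > 0 \<Longrightarrow> q (c *\<^sub>R z) = c powr \<alpha> * q z"
    and lim: "\<And>w. ((\<lambda>t. t powr (- \<alpha> / 2) * f (sqrt t *\<^sub>R w)) \<longlongrightarrow> q w) (at_right 0)"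
  defines "\<beta> \<equiv> (real DIM('a) + \<alpha>) / 2"
  obtains c D where
    "((\<lambda>\<delta>. (LINT t:{\<delta><..}|lborel. \<integral>z. f z * heat_weight \<beta> (norm z) t \<partial>lborel) -
        4 powr \<beta> * Gamma \<beta> * (\<integral>z. indicator {z. norm z > sqrt \<delta>} z * (f z / norm z powr (real DIM('a) + \<alpha>)) \<partial>lborel))
        \<longlongrightarrow> D) (at_right 0)"
    "((\<lambda>t. t * (\<integral>z. f z * heat_weight \<beta> (norm z) t \<partial>lborel)) \<longlongrightarrow> c) (at_right 0)"
    "c = 0 \<Longrightarrow> D = 0"
proof -
  define A where "A = 4 powr \<beta> * Gamma \<beta>"
  have \<beta>: "\<beta> > 0" using \<alpha> unfolding \<beta>_def by (intro divide_pos_pos add_nonneg_pos) auto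
  have \<beta>2: "- 2 * \<beta> = - (real DIM('a) + \<alpha>)" by (simp add: \<beta>_def)
  \<comment> \<open>Soft minus sharp cut-off at scale 1. Both scale by
    \<open>\<delta> powr (- \<beta>)\<close>, so the same \<open>k\<close> serves every
    \<open>\<delta>\<close>.\<close>
  define k where "k r = heat_tail \<beta> 1 r - A * r powr (- 2 * \<beta>) * indicator {1<..} r" for r
  have [measurable]: "k \<in> borel_measurable borel" unfolding k_def by measurable
  obtain C where C: "C > 0" "\<And>r. r \<ge> 0 \<Longrightarrow> \<bar>k r\<bar> \<le> C * exp (- (1/8) * r\<^sup>2)"
    using heat_tail_cutoff_bound[OF \<beta>] unfolding k_def A_def by metis
  have sqrt_pow: "sqrt \<delta> ^ DIM('a) = \<delta> powr (DIM('a) / 2)" if "\<delta> > 0" for \<delta> :: real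
    using that by (simp add: powr_half_sqrt[symmetric] powr_power)
  have f_le: "\<bar>t powr (- \<alpha> / 2) * f (sqrt t *\<^sub>R w)\<bar> \<le> M * norm w powr \<alpha>" if "t > 0" for t w
  proof -
    have "t powr (- \<alpha> / 2) * \<bar>f (sqrt t *\<^sub>R w)\<bar> \<le> t powr (- \<alpha> / 2) * (M * norm (sqrt t *\<^sub>R w) powr \<alpha>)"
      by (intro mult_left_mono le) simp
    also have "norm (sqrt t *\<^sub>R w) powr \<alpha> = t powr (\<alpha> / 2) * norm w powr \<alpha>"
      using that by (simp add: powr_mult powr_half_sqrt[symmetric] powr_powr)
    also have "t powr (- \<alpha> / 2) * (M * (t powr (\<alpha> / 2) * norm w powr \<alpha>)) =
       (t powr (- \<alpha> / 2) * t powr (\<alpha> / 2)) * (M * norm w powr \<alpha>)" by (simp add: mult_ac)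
    also have "t powr (- \<alpha> / 2) * t powr (\<alpha> / 2) = 1"
      using that by (simp add: powr_add[symmetric])
    finally show ?thesis by (simp add: abs_mult)
  qed
  have int_k: "integrable lborel (\<lambda>w::'a. k (norm w) * norm w powr \<alpha>)"
  proof (rule Bochner_Integration.integrable_bound)
    show "integrable lborel (\<lambda>w::'a. C * (norm w powr \<alpha> * exp (- (1/8) * (norm w)\<^sup>2)))"
      using \<alpha> by (intro integrable_mult_right integrable_powr_gaussian) auto
    show "AE w in lborel. norm (k (norm w) * norm w powr \<alpha>) \<le>
        norm (C * (norm (w::'a) powr \<alpha> * exp (- (1/8) * (norm w)\<^sup>2)))"
    proof (intro AE_I2)
      fix w :: 'a
      have "\<bar>k (norm w)\<bar> * norm w powr \<alpha> \<le> C * exp (- (1/8) * (norm w)\<^sup>2) * norm w powr \<alpha>"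
        using C by (intro mult_right_mono) auto
      then show "norm (k (norm w) * norm w powr \<alpha>) \<le>
        norm (C * (norm (w::'a) powr \<alpha> * exp (- (1/8) * (norm w)\<^sup>2)))"
        using C by (simp add: abs_mult mult_ac)
    qed
  qed measurable
  have diff: "(LINT t:{\<delta><..}|lborel. \<integral>z. f z * heat_weight \<beta> (norm z) t \<partial>lborel) -
        A * (\<integral>z. indicator {z. norm z > sqrt \<delta>} z * (f z / norm z powr (real DIM('a) + \<alpha>)) \<partial>lborel) =
      (\<integral>w. k (norm w) * (\<delta> powr (- \<alpha> / 2) * f (sqrt \<delta> *\<^sub>R w)) \<partial>lborel)" if \<delta>: "\<delta> > 0" for \<delta>
  proof -
    \<comment> \<open>For fixed \<open>\<delta> > 0\<close> boundedness of \<open>f\<close> makes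
      both integrals converge, so they may be merged into one.\<close>
    note hf = heat_fubini[OF assms(1) heat_finite_bounded[OF assms(1) bnd \<delta> \<alpha>], folded \<beta>_def]
    have it: "integrable lborel (\<lambda>z. indicator {z. norm z > sqrt \<delta>} z * (f z / norm z powr (real DIM('a) + \<alpha>)))"
      using integrable_truncated_kernel[OF assms(1) bnd \<alpha>] \<delta> by simp
    let ?G = "\<lambda>z. f z * heat_tail \<beta> \<delta> (norm z) -
        A * (indicator {z. norm z > sqrt \<delta>} z * (f z / norm z powr (real DIM('a) + \<alpha>)))"
    have "(LINT t:{\<delta><..}|lborel. \<integral>z. f z * heat_weight \<beta> (norm z) t \<partial>lborel) -
        A * (\<integral>z. indicator {z. norm z > sqrt \<delta>} z * (f z / norm z powr (real DIM('a) + \<alpha>)) \<partial>lborel) =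
        (\<integral>z. ?G z \<partial>lborel)"
      unfolding hf(3)
      by (subst Bochner_Integration.integral_diff[OF hf(1) integrable_mult_right[OF it]])
         (simp only: integral_mult_right_zero)
    also have "\<dots> = \<bar>sqrt \<delta>\<bar> ^ DIM('a) * (\<integral>w. ?G (sqrt \<delta> *\<^sub>R w) \<partial>lborel)"
      using \<delta> by (intro lborel_integral_scaleR(2)) auto
    also have "(\<lambda>w. ?G (sqrt \<delta> *\<^sub>R w)) =
       (\<lambda>w. \<delta> powr (- \<beta>) * (k (norm w) * f (sqrt \<delta> *\<^sub>R w)))"
    proof
      fix w :: 'a
      have 1: "norm (sqrt \<delta> *\<^sub>R w) = sqrt \<delta> * norm w" using \<delta> by simp
      have 2: "1 / (sqrt \<delta> * norm w) powr (real DIM('a) + \<alpha>) = \<delta> powr (- \<beta>) * norm w powr (- 2 * \<beta>)"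
      proof -
        have "1 / (sqrt \<delta> * norm w) powr (real DIM('a) + \<alpha>) = (sqrt \<delta> * norm w) powr (- 2 * \<beta>)"
          unfolding \<beta>2 by (rule powr_minus_divide[symmetric])
        also have "\<dots> = sqrt \<delta> powr (- 2 * \<beta>) * norm w powr (- 2 * \<beta>)"
          by (rule powr_mult)
        also have "sqrt \<delta> powr (- 2 * \<beta>) = \<delta> powr (- \<beta>)"
          using \<delta> by (simp add: powr_half_sqrt[symmetric] powr_powr)
        finally show ?thesis .
      qed
      have 3: "indicator {z. norm z > sqrt \<delta>} (sqrt \<delta> *\<^sub>R w) = (indicator {1<..} (norm w) :: real)"
        using \<delta> by (auto split: split_indicator)
      have 4: "f (sqrt \<delta> *\<^sub>R w) / (sqrt \<delta> * norm w) powr (real DIM('a) + \<alpha>) =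
          f (sqrt \<delta> *\<^sub>R w) * (\<delta> powr (- \<beta>) * norm w powr (- 2 * \<beta>))"
        unfolding 2[symmetric] by simp
      show "?G (sqrt \<delta> *\<^sub>R w) = \<delta> powr (- \<beta>) * (k (norm w) * f (sqrt \<delta> *\<^sub>R w))"
        unfolding 1 3 4 k_def heat_tail_scale[OF \<delta>] by (simp only: algebra_simps)
    qed
    also have "\<bar>sqrt \<delta>\<bar> ^ DIM('a) * (\<integral>w. \<delta> powr (- \<beta>) * (k (norm w) * f (sqrt \<delta> *\<^sub>R w)) \<partial>lborel) =
        (\<delta> powr (DIM('a) / 2) * \<delta> powr (- \<beta>)) * (\<integral>w. k (norm w) * f (sqrt \<delta> *\<^sub>R w) \<partial>lborel)"
      using \<delta> by (simp add: sqrt_pow)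
    also have "\<delta> powr (DIM('a) / 2) * \<delta> powr (- \<beta>) = \<delta> powr (- \<alpha> / 2)"
      unfolding powr_add[symmetric] \<beta>_def by (simp add: field_simps)
    also have "\<delta> powr (- \<alpha> / 2) * (\<integral>w. k (norm w) * f (sqrt \<delta> *\<^sub>R w) \<partial>lborel) =
        (\<integral>w. k (norm w) * (\<delta> powr (- \<alpha> / 2) * f (sqrt \<delta> *\<^sub>R w)) \<partial>lborel)"
      by (subst integral_mult_right_zero[symmetric]) (simp only: mult.left_commute)
    finally show ?thesis .
  qed
  \<comment> \<open>The powers of \<open>t\<close> add up to
    \<open>1 + n / 2 - 1 - \<beta> = - \<alpha> / 2\<close>, the normalisation of \<open>f\<close>
    at its critical degree; this is why the factor \<open>t\<close> gives a limit.\<close>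
  have heat: "t * (\<integral>z. f z * heat_weight \<beta> (norm z) t \<partial>lborel) =
      (\<integral>w. exp (- (1/4) * (norm w)\<^sup>2) * (t powr (- \<alpha> / 2) * f (sqrt t *\<^sub>R w)) \<partial>lborel)" if t: "t > 0" for t
  proof -
    have "(\<integral>z. f z * heat_weight \<beta> (norm z) t \<partial>lborel) =
       \<bar>sqrt t\<bar> ^ DIM('a) * (\<integral>w. f (sqrt t *\<^sub>R w) * heat_weight \<beta> (norm (sqrt t *\<^sub>R w)) t \<partial>lborel)"
      using t by (intro lborel_integral_scaleR(2)) auto
    also have "(\<lambda>w. f (sqrt t *\<^sub>R w) * heat_weight \<beta> (norm (sqrt t *\<^sub>R w)) t) =
       (\<lambda>w. t powr (- 1 - \<beta>) * (exp (- (1/4) * (norm w)\<^sup>2) * f (sqrt t *\<^sub>R w)))"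
      using t by (auto simp: heat_weight_def power_mult_distrib fun_eq_iff)
    also have "t * (\<bar>sqrt t\<bar> ^ DIM('a) * (\<integral>w. t powr (- 1 - \<beta>) * (exp (- (1/4) * (norm w)\<^sup>2) * f (sqrt t *\<^sub>R w)) \<partial>lborel))
      = (t powr 1 * t powr (DIM('a) / 2) * t powr (- 1 - \<beta>)) * (\<integral>w. exp (- (1/4) * (norm w)\<^sup>2) * f (sqrt t *\<^sub>R w) \<partial>lborel)"
      using t by (simp add: sqrt_pow)
    also have "t powr 1 * t powr (DIM('a) / 2) * t powr (- 1 - \<beta>) = t powr (- \<alpha> / 2)"
      unfolding powr_add[symmetric] \<beta>_def by (simp add: field_simps)
    also have "t powr (- \<alpha> / 2) * (\<integral>w. exp (- (1/4) * (norm w)\<^sup>2) * f (sqrt t *\<^sub>R w) \<partial>lborel) =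
        (\<integral>w. exp (- (1/4) * (norm w)\<^sup>2) * (t powr (- \<alpha> / 2) * f (sqrt t *\<^sub>R w)) \<partial>lborel)"
      by (subst integral_mult_right_zero[symmetric]) (simp only: mult.left_commute)
    finally show ?thesis .
  qed
  define D where "D = (\<integral>w. k (norm w) * q w \<partial>lborel)"
  define c where "c = (\<integral>w. exp (- (1/4) * (norm w)\<^sup>2) * q w \<partial>lborel)"
  \<comment> \<open>One dominated convergence argument for all radial kernels that integrate
    \<open>norm w powr \<alpha>\<close>; it is used for \<open>k\<close> and for the
    Gaussian.\<close>
  have limit: "((\<lambda>t. \<integral>w. F (norm w) * (t powr (- \<alpha> / 2) * f (sqrt t *\<^sub>R w)) \<partial>lborel)
      \<longlongrightarrow> (\<integral>w. F (norm w) * q w \<partial>lborel)) (at_right 0)"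
    if [measurable]: "F \<in> borel_measurable borel" and int: "integrable lborel (\<lambda>w::'a. F (norm w) * norm w powr \<alpha>)"
    for F :: "real \<Rightarrow> real"
  proof (rule integral_dominated_convergence_at_right)
    show "integrable lborel (\<lambda>w::'a. M * norm (F (norm w) * norm w powr \<alpha>))"
      using int by (intro integrable_mult_right integrable_norm)
    show "AE w in lborel. ((\<lambda>t. F (norm w) * (t powr (- \<alpha> / 2) * f (sqrt t *\<^sub>R w))) \<longlongrightarrow> F (norm w) * q w) (at_right 0)"
      by (intro AE_I2 tendsto_mult tendsto_const lim)
    show "AE w in lborel. norm (F (norm w) * (t powr (- \<alpha> / 2) * f (sqrt t *\<^sub>R w))) \<le> M * norm (F (norm w) * norm w powr \<alpha>)"
      if "t > 0" for t
    proof (intro AE_I2)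
      fix w
      have "\<bar>F (norm w)\<bar> * \<bar>t powr (- \<alpha> / 2) * f (sqrt t *\<^sub>R w)\<bar> \<le> \<bar>F (norm w)\<bar> * (M * norm w powr \<alpha>)"
        by (intro mult_left_mono f_le that) simp
      then show "norm (F (norm w) * (t powr (- \<alpha> / 2) * f (sqrt t *\<^sub>R w))) \<le> M * norm (F (norm w) * norm w powr \<alpha>)"
        by (simp add: abs_mult mult_ac)
    qed
  qed measurable
  have int_g: "integrable lborel (\<lambda>w. exp (- (1/4) * (norm w)\<^sup>2) * norm (w::'a) powr \<alpha>)"
    using integrable_powr_gaussian[of "1/4" \<alpha>, where 'a = 'a] \<alpha> by (simp add: mult.commute)
  show thesis
  proof
    show "((\<lambda>\<delta>. (LINT t:{\<delta><..}|lborel. \<integral>z. f z * heat_weight \<beta> (norm z) t \<partial>lborel) -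
        4 powr \<beta> * Gamma \<beta> * (\<integral>z. indicator {z. norm z > sqrt \<delta>} z * (f z / norm z powr (real DIM('a) + \<alpha>)) \<partial>lborel))
        \<longlongrightarrow> D) (at_right 0)"
      unfolding D_def A_def[symmetric]
    proof (rule Lim_transform_eventually[OF limit[of k, OF _ int_k]])
      show "\<forall>\<^sub>F \<delta> in at_right 0. (\<integral>w. k (norm w) * (\<delta> powr (- \<alpha> / 2) * f (sqrt \<delta> *\<^sub>R w)) \<partial>lborel) =
          (LINT t:{\<delta><..}|lborel. \<integral>z. f z * heat_weight \<beta> (norm z) t \<partial>lborel) -
          A * (\<integral>z. indicator {z. norm z > sqrt \<delta>} z * (f z / norm z powr (real DIM('a) + \<alpha>)) \<partial>lborel)"
        using eventually_at_right_less[of 0] by eventually_elim (rule diff[symmetric])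
    qed measurable
    show "((\<lambda>t. t * (\<integral>z. f z * heat_weight \<beta> (norm z) t \<partial>lborel)) \<longlongrightarrow> c) (at_right 0)"
      unfolding c_def
    proof (rule Lim_transform_eventually[OF limit[of "\<lambda>r. exp (- (1/4) * r\<^sup>2)", OF _ int_g]])
      show "\<forall>\<^sub>F t in at_right 0. (\<integral>w. exp (- (1/4) * (norm w)\<^sup>2) * (t powr (- \<alpha> / 2) * f (sqrt t *\<^sub>R w)) \<partial>lborel) =
          t * (\<integral>z. f z * heat_weight \<beta> (norm z) t \<partial>lborel)"
        using eventually_at_right_less[of 0] by eventually_elim (rule heat[symmetric])
    qed measurable
    obtain \<kappa> :: real where \<kappa>: "\<And>F :: real \<Rightarrow> real. F \<in> borel_measurable borel \<Longrightarrow>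
      integrable lborel (\<lambda>w::'a. F (norm w) * norm w powr \<alpha>) \<Longrightarrow>
      (\<integral>w. F (norm w) * q w \<partial>lborel) = \<kappa> * (\<integral>w. F (norm (w::'a)) * norm w powr \<alpha> \<partial>lborel)"
    proof (rule radial_integral_homogeneous[OF assms(2) hom leq less_imp_le[OF \<alpha>]], goal_cases)
      case (2 \<kappa>)
      show ?case by (rule 2(1)) (rule 2(2))
    qed
    \<comment> \<open>\<open>c\<close> and \<open>D\<close> are the same factor
      \<open>\<kappa>\<close> times two radial integrals, and the one belonging to \<open>c\<close>
      is nonzero.\<close>
    show "D = 0" if "c = 0"
    proof -
      have "c = \<kappa> * (\<integral>w. exp (- (1/4) * (norm w)\<^sup>2) * norm (w::'a) powr \<alpha> \<partial>lborel)"
        unfolding c_def by (rule \<kappa>[of "\<lambda>r. exp (- (1/4) * r\<^sup>2)"]) (use int_g in auto)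
      then have "\<kappa> = 0" using that integral_powr_gaussian_pos[of \<alpha>, where 'a = 'a] \<alpha> by simp
      then show ?thesis unfolding D_def using \<kappa>[of k] int_k by simp
    qed
  qed
qed

text \<open>Near 0 the integrand exceeds \<open>c / (2 t)\<close>, so the tail grows at least like
  \<open>- c / 2 * ln \<delta>\<close>.\<close>

lemma tail_integral_at_top:
  fixes e :: "real \<Rightarrow> real"
  assumes int: "\<And>\<delta>. \<delta> > 0 \<Longrightarrow> set_integrable lborel {\<delta><..} e"
    and lim: "((\<lambda>t. t * e t) \<longlongrightarrow> c) (at_right 0)" and "c > 0"
  shows "filterlim (\<lambda>\<delta>. LINT t:{\<delta><..}|lborel. e t) at_top (at_right 0)"
proof -
  have "\<forall>\<^sub>F t in at_right 0. t * e t > c / 2"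
    using lim \<open>c > 0\<close> by (intro order_tendstoD(1)) auto
  then obtain b where b: "b > 0" "\<And>t. 0 < t \<Longrightarrow> t < b \<Longrightarrow> t * e t > c / 2"
    by (auto simp: eventually_at_right_field)
  \<comment> \<open>Half of \<open>b\<close> keeps the strict lower bound valid up to and including
    \<open>T\<close>.\<close>
  define T where "T = b / 2"
  have T: "T > 0" "T < b" using b by (auto simp: T_def)
  have lower: "(c / 2) * (ln T - ln \<delta>) + (LINT t:{T<..}|lborel. e t) \<le> (LINT t:{\<delta><..}|lborel. e t)"
    if \<delta>: "0 < \<delta>" "\<delta> < T" for \<delta>
  proof -
    have eq: "{\<delta><..} = {\<delta><..T} \<union> {T<..}" using \<delta> by auto
    have i1: "set_integrable lborel {\<delta><..T} e"
      by (rule set_integrable_subset[OF int[OF \<delta>(1)]]) auto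
    have "(LINT t:{\<delta><..}|lborel. e t) = (LINT t:{\<delta><..T}|lborel. e t) + (LINT t:{T<..}|lborel. e t)"
      unfolding eq using i1 int[OF T(1)] by (intro set_integral_Un) auto
    moreover have "c / 2 * ln T - c / 2 * ln \<delta> \<le> (LINT t:{\<delta><..T}|lborel. e t)"
    proof -
      have hb: "has_bochner_integral lborel (\<lambda>t. (c / 2 * (1 / t)) * indicator {\<delta>..T} t) (c / 2 * ln T - c / 2 * ln \<delta>)"
        using \<delta> \<open>c > 0\<close>
        by (intro has_bochner_integral_FTC_Icc_nonneg)
          (auto intro!: derivative_eq_intros continuous_intros
             simp: has_real_derivative_iff_has_vector_derivative[symmetric])
      have "(\<integral>t. (c / 2 * (1 / t)) * indicator {\<delta>..T} t \<partial>lborel) \<le> (LINT t:{\<delta><..T}|lborel. e t)"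
        unfolding set_lebesgue_integral_def
      proof (rule integral_mono_AE)
        show "integrable lborel (\<lambda>t. (c / 2 * (1 / t)) * indicator {\<delta>..T} t)"
          using hb by (rule integrable.intros)
        show "integrable lborel (\<lambda>t. indicator {\<delta><..T} t *\<^sub>R e t)"
          using i1 by (simp add: set_integrable_def)
        show "AE t in lborel. (c / 2 * (1 / t)) * indicator {\<delta>..T} t \<le> indicator {\<delta><..T} t *\<^sub>R e t"
          using AE_lborel_singleton[of \<delta>]
        proof eventually_elim
          fix t assume "t \<noteq> \<delta>"
          then show "(c / 2 * (1 / t)) * indicator {\<delta>..T} t \<le> indicator {\<delta><..T} t *\<^sub>R e t"
            using b(2)[of t] \<delta> T by (auto simp: field_simps split: split_indicator)
        qed
      qed
      then show ?thesis using hb by (simp add: has_bochner_integral_integral_eq)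
    qed
    ultimately show ?thesis by (simp add: algebra_simps)
  qed
  have "filterlim (\<lambda>\<delta>. (c / 2 * ln T + (LINT t:{T<..}|lborel. e t)) + c / 2 * (- ln \<delta>)) at_top (at_right 0)"
    using \<open>c > 0\<close> ln_at_0
    by (intro filterlim_tendsto_add_at_top[OF tendsto_const] filterlim_tendsto_pos_mult_at_top[OF tendsto_const])
       (auto simp: filterlim_uminus_at_bot)
  then have "filterlim (\<lambda>\<delta>. (c / 2) * (ln T - ln \<delta>) + (LINT t:{T<..}|lborel. e t)) at_top (at_right 0)"
    by (simp add: algebra_simps diff_divide_distrib)
  then show ?thesis
    by (rule filterlim_at_top_mono)
       (use lower T in \<open>auto simp: eventually_at_right_field\<close>)
qed

section \<open>Principal value and heat integral of the even part\<close>

text \<open>\<open>f\<close> itself need not be absolutely integrable against the singular kernel.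
  For each fixed \<open>\<epsilon>\<close> or \<open>t\<close>, however, it is integrable against
  the truncated kernel or \<open>heat_weight\<close>, and there radial symmetry replaces it by its
  even part. Only then is the limit taken.\<close>

lemma heat_pv_symmetrized:
  fixes f h :: "'a::euclidean_space \<Rightarrow> real"
  assumes [measurable]: "f \<in> borel_measurable borel" "h \<in> borel_measurable borel"
    and bnd: "\<And>z. \<bar>f z\<bar> \<le> B" and \<alpha>: "\<alpha> > 0" "\<gamma> > \<alpha>"
    and hom: "\<And>c z. c > 0 \<Longrightarrow> h (c *\<^sub>R z) = c powr \<gamma> * h z"
    and le: "AE z in lborel. \<bar>(f z + f (- z)) / 2\<bar> \<le> h z"
    and int: "integrable lborel (\<lambda>z. h z * exp (- (1/4) * (norm z)\<^sup>2))"
  defines "\<beta> \<equiv> (real DIM('a) + \<alpha>) / 2"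
  obtains I where
    "((\<lambda>\<epsilon>. \<integral>z. indicator {z. norm z > \<epsilon>} z * (f z / norm z powr (real DIM('a) + \<alpha>)) \<partial>lborel) \<longlongrightarrow> I) (at_right 0)"
    "set_integrable lborel {0<..} (\<lambda>t. \<integral>z. f z * heat_weight \<beta> (norm z) t \<partial>lborel)"
    "(LINT t:{0<..}|lborel. \<integral>z. f z * heat_weight \<beta> (norm z) t \<partial>lborel) = 4 powr \<beta> * Gamma \<beta> * I"
proof -
  define S where "S z = (f z + f (- z)) / 2" for z
  have [measurable]: "S \<in> borel_measurable borel" unfolding S_def by measurable
  have bS: "\<bar>S z\<bar> \<le> B" for z using bnd[of z] bnd[of "- z"] by (simp add: S_def abs_le_iff)
  have "AE z in lborel. \<bar>S z\<bar> \<le> h z" using le by (simp add: S_def)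
  note hf = heat_fubini_0[OF \<open>S \<in> _\<close> \<alpha>(1) heat_finite_homogeneous[OF \<open>S \<in> _\<close> assms(2) bS \<alpha> hom this int], folded \<beta>_def]
  define J where "J = (\<integral>z. S z / norm z powr (real DIM('a) + \<alpha>) \<partial>lborel)"
  have pv: "(\<integral>z. indicator {z. norm z > \<epsilon>} z * (f z / norm z powr (real DIM('a) + \<alpha>)) \<partial>lborel) =
      (\<integral>z. indicator {z. norm z > \<epsilon>} z * (S z / norm z powr (real DIM('a) + \<alpha>)) \<partial>lborel)" if "\<epsilon> > 0" for \<epsilon>
    unfolding integral_even_part[OF integrable_truncated_kernel[OF assms(1) bnd \<alpha>(1) that], symmetric]
    by (intro Bochner_Integration.integral_cong) (auto simp: S_def add_divide_distrib split: split_indicator)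
  have heat: "(\<integral>z. f z * heat_weight \<beta> (norm z) t \<partial>lborel) = (\<integral>z. S z * heat_weight \<beta> (norm z) t \<partial>lborel)"
    if "t > 0" for t
  proof -
    have "integrable lborel (\<lambda>z. f z * heat_weight \<beta> (norm z) t)"
    proof (rule integrableI_bounded)
      have "ennreal (t powr (- 1 - \<alpha> / 2)) * (ennreal B * (\<integral>\<^sup>+z. ennreal (exp (- (1/4) * (norm (z::'a))\<^sup>2)) \<partial>lborel)) < \<infinity>"
        using gaussian_nn_integral_finite[of "1/4", where 'a = 'a] by (simp add: ennreal_mult_less_top)
      then show "(\<integral>\<^sup>+z. ennreal (norm (f z * heat_weight \<beta> (norm z) t)) \<partial>lborel) < \<infinity>"
        using heat_nn_integral_bounded[OF assms(1) bnd that, of \<alpha>] by (simp add: abs_mult \<beta>_def)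
    qed measurable
    from integral_even_part[OF this] show ?thesis
      by (simp add: S_def add_divide_distrib distrib_right)
  qed
  show thesis
  proof
    show "((\<lambda>\<epsilon>. \<integral>z. indicator {z. norm z > \<epsilon>} z * (f z / norm z powr (real DIM('a) + \<alpha>)) \<partial>lborel) \<longlongrightarrow> J) (at_right 0)"
    proof (rule Lim_transform_eventually)
      show "((\<lambda>\<epsilon>. \<integral>z. indicator {z. norm z > \<epsilon>} z * (S z / norm z powr (real DIM('a) + \<alpha>)) \<partial>lborel) \<longlongrightarrow> J) (at_right 0)"
        unfolding J_def
      proof (rule integral_dominated_convergence_at_right)
        show "integrable lborel (\<lambda>z. norm (S z / norm z powr (real DIM('a) + \<alpha>)))"
          using hf(1) by (rule integrable_norm)
        show "AE z in lborel. ((\<lambda>\<epsilon>. indicator {z. norm z > \<epsilon>} z * (S z / norm z powr (real DIM('a) + \<alpha>)))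
           \<longlongrightarrow> S z / norm z powr (real DIM('a) + \<alpha>)) (at_right 0)"
        proof (intro AE_I2)
          fix z :: 'a
          have "\<forall>\<^sub>F \<epsilon> in at_right 0. S z / norm z powr (real DIM('a) + \<alpha>) =
             indicator {z. norm z > \<epsilon>} z * (S z / norm z powr (real DIM('a) + \<alpha>))"
          \<comment> \<open>At \<open>z = 0\<close> the indicator never becomes 1, but the kernel is
            0 there, since \<open>0 powr a = 0\<close> and division by 0 yields 0.\<close>
          proof (cases "z = 0")
            case False
            then show ?thesis by (auto simp: eventually_at_right_field intro!: exI[of _ "norm z"])
          qed simp
          then show "((\<lambda>\<epsilon>. indicator {z. norm z > \<epsilon>} z * (S z / norm z powr (real DIM('a) + \<alpha>)))
           \<longlongrightarrow> S z / norm z powr (real DIM('a) + \<alpha>)) (at_right 0)"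
            by (rule Lim_transform_eventually[OF tendsto_const])
        qed
      qed (auto split: split_indicator)
      show "\<forall>\<^sub>F \<epsilon> in at_right 0. (\<integral>z. indicator {z. norm z > \<epsilon>} z * (S z / norm z powr (real DIM('a) + \<alpha>)) \<partial>lborel) =
         (\<integral>z. indicator {z. norm z > \<epsilon>} z * (f z / norm z powr (real DIM('a) + \<alpha>)) \<partial>lborel)"
        using eventually_at_right_less[of 0] by eventually_elim (rule pv[symmetric])
    qed
    show "set_integrable lborel {0<..} (\<lambda>t. \<integral>z. f z * heat_weight \<beta> (norm z) t \<partial>lborel)"
      using hf(2) by (subst set_integrable_cong[OF refl refl heat]) auto
    have "(LINT t:{0<..}|lborel. \<integral>z. f z * heat_weight \<beta> (norm z) t \<partial>lborel) =
        (LINT t:{0<..}|lborel. \<integral>z. S z * heat_weight \<beta> (norm z) t \<partial>lborel)"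
      by (rule set_lebesgue_integral_cong) (auto simp: heat)
    also note hf(3)
    finally show "(LINT t:{0<..}|lborel. \<integral>z. f z * heat_weight \<beta> (norm z) t \<partial>lborel) = 4 powr \<beta> * Gamma \<beta> * J"
      unfolding J_def .
  qed
qed

lemma tail_integral_tendsto:
  fixes e :: "real \<Rightarrow> real"
  assumes "set_integrable lborel {0<..} e"
  shows "((\<lambda>\<delta>. LINT t:{\<delta><..}|lborel. e t) \<longlongrightarrow> (LINT t:{0<..}|lborel. e t)) (at_right 0)"
  unfolding set_lebesgue_integral_def
proof (rule integral_dominated_convergence_at_right)
  have i: "set_integrable lborel {\<delta><..} e" if "\<delta> > 0" for \<delta>
    by (rule set_integrable_subset[OF assms]) (use that in auto)
  show "integrable lborel (\<lambda>t. norm (indicator {0<..} t *\<^sub>R e t))"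
    using assms unfolding set_integrable_def by (rule integrable_norm)
  show "(\<lambda>t. indicator {0<..} t *\<^sub>R e t) \<in> borel_measurable lborel"
    using assms unfolding set_integrable_def by auto
  show "(\<lambda>t. indicator {\<delta><..} t *\<^sub>R e t) \<in> borel_measurable lborel" if "\<delta> > 0" for \<delta>
    using i[OF that] unfolding set_integrable_def by auto
  show "AE t in lborel. ((\<lambda>\<delta>. indicator {\<delta><..} t *\<^sub>R e t) \<longlongrightarrow> indicator {0<..} t *\<^sub>R e t) (at_right 0)"
  proof (intro AE_I2)
    fix t :: real
    have "\<forall>\<^sub>F \<delta> in at_right 0. indicator {0<..} t *\<^sub>R e t = indicator {\<delta><..} t *\<^sub>R e t"
    proof (cases "t > 0")
      case True
      then show ?thesis by (auto simp: eventually_at_right_field intro!: exI[of _ t])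
    next
      case False
      then show ?thesis
        by (auto intro!: eventually_at_right_less[THEN eventually_mono] split: split_indicator)
    qed
    then show "((\<lambda>\<delta>. indicator {\<delta><..} t *\<^sub>R e t) \<longlongrightarrow> indicator {0<..} t *\<^sub>R e t) (at_right 0)"
      by (rule Lim_transform_eventually[OF tendsto_const])
  qed
qed (auto split: split_indicator)

text \<open>A discrepancy \<open>D\<close> would shift a finite limit; it is harmless only if it is
  0 or if both sides run off to the same infinity, in which case uniqueness of limits leaves a
  single possible \<open>L\<close>.\<close>

lemma extended_limit_iff:
  fixes a b :: "real \<Rightarrow> real" and L :: ereal
  assumes lim: "((\<lambda>\<delta>. b \<delta> - a (sqrt \<delta>)) \<longlongrightarrow> D) (at_right 0)"
    and cases: "D = 0 \<or> filterlim b at_top (at_right 0) \<or> filterlim b at_bot (at_right 0)"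
  shows "((\<lambda>\<epsilon>. ereal (a \<epsilon>)) \<longlongrightarrow> L) (at_right 0) \<longleftrightarrow> ((\<lambda>\<delta>. ereal (b \<delta>)) \<longlongrightarrow> L) (at_right 0)"
proof -
  \<comment> \<open>\<open>sqrt\<close> and squaring preserve \<open>at_right 0\<close>, so the
    truncation radius may be replaced by the square root of a time.\<close>
  have sq: "((\<lambda>\<epsilon>. ereal (a \<epsilon>)) \<longlongrightarrow> L) (at_right 0) \<longleftrightarrow> ((\<lambda>\<epsilon>. ereal (a (sqrt \<epsilon>))) \<longlongrightarrow> L) (at_right 0)"
  proof
    have s: "filterlim sqrt (at_right 0) (at_right (0::real))"
      by (intro tendsto_imp_filterlim_at_right tendsto_eq_intros) (auto intro!: eventually_at_right_less[THEN eventually_mono])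
    have s2: "filterlim (\<lambda>x. x\<^sup>2) (at_right 0) (at_right (0::real))"
      by (intro tendsto_imp_filterlim_at_right tendsto_eq_intros) (auto intro!: eventually_at_right_less[THEN eventually_mono])
    show "((\<lambda>\<epsilon>. ereal (a (sqrt \<epsilon>))) \<longlongrightarrow> L) (at_right 0)" if "((\<lambda>\<epsilon>. ereal (a \<epsilon>)) \<longlongrightarrow> L) (at_right 0)"
      using filterlim_compose[OF that s] .
    show "((\<lambda>\<epsilon>. ereal (a \<epsilon>)) \<longlongrightarrow> L) (at_right 0)" if "((\<lambda>\<epsilon>. ereal (a (sqrt \<epsilon>))) \<longlongrightarrow> L) (at_right 0)"
      using filterlim_compose[OF that s2]
      by (rule Lim_transform_eventually) (auto intro!: eventually_at_right_less[THEN eventually_mono])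
  qed
  consider "D = 0" | "filterlim b at_top (at_right 0)" | "filterlim b at_bot (at_right 0)"
    using cases by blast
  then show ?thesis
  proof cases
    case 1
    have e: "((\<lambda>\<delta>. ereal (b \<delta> - a (sqrt \<delta>))) \<longlongrightarrow> 0) (at_right 0)"
      using lim 1 by (simp add: zero_ereal_def)
    have e': "((\<lambda>\<delta>. ereal (a (sqrt \<delta>) - b \<delta>)) \<longlongrightarrow> 0) (at_right 0)"
      using tendsto_minus[OF lim] 1 by (simp add: zero_ereal_def)
    show ?thesis
      unfolding sq
    proof
      assume "((\<lambda>\<delta>. ereal (a (sqrt \<delta>))) \<longlongrightarrow> L) (at_right 0)"
      from tendsto_add_ereal_general1[OF _ this e] show "((\<lambda>\<delta>. ereal (b \<delta>)) \<longlongrightarrow> L) (at_right 0)" by simp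
    next
      assume "((\<lambda>\<delta>. ereal (b \<delta>)) \<longlongrightarrow> L) (at_right 0)"
      from tendsto_add_ereal_general1[OF _ this e'] show "((\<lambda>\<delta>. ereal (a (sqrt \<delta>))) \<longlongrightarrow> L) (at_right 0)" by simp
    qed
  next
    case 2
    then have a: "filterlim (\<lambda>\<delta>. a (sqrt \<delta>)) at_top (at_right 0)"
      using filterlim_tendsto_add_at_top[OF tendsto_minus[OF lim] 2] by simp
    have "((\<lambda>\<delta>. ereal (a (sqrt \<delta>))) \<longlongrightarrow> \<infinity>) (at_right 0)" "((\<lambda>\<delta>. ereal (b \<delta>)) \<longlongrightarrow> \<infinity>) (at_right 0)"
      using a 2 by (simp_all add: tendsto_PInfty_eq_at_top)
    then show ?thesis
      unfolding sq by (metis tendsto_unique trivial_limit_at_right_real)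
  next
    case 3
    then have a: "filterlim (\<lambda>\<delta>. a (sqrt \<delta>)) at_bot (at_right 0)"
      using filterlim_tendsto_add_at_bot_iff[OF tendsto_minus[OF lim], THEN iffD2, OF 3] by simp
    have "((\<lambda>\<delta>. ereal (a (sqrt \<delta>))) \<longlongrightarrow> -\<infinity>) (at_right 0)" "((\<lambda>\<delta>. ereal (b \<delta>)) \<longlongrightarrow> -\<infinity>) (at_right 0)"
      using a 3 by (auto simp: tendsto_MInfty filterlim_at_bot_dense)
    then show ?thesis
      unfolding sq by (metis tendsto_unique trivial_limit_at_right_real)
  qed
qed

subsection \<open>The nonlinearity and the Taylor expansion\<close>

lemma Phi_0 [simp]: "Phi p 0 = 0"
  by (simp add: Phi_def)

lemma Phi_minus: "Phi p (- a) = - Phi p a"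
  by (simp add: Phi_def)

text \<open>Multiplicativity allows a nonzero argument to be factored out, so that differences of
  \<open>Phi p\<close> reduce to a comparison with \<open>Phi p 1 = 1\<close>.\<close>

lemma Phi_mult: "Phi p (a * b) = Phi p a * Phi p b"
  by (simp add: Phi_def abs_mult powr_mult)

lemma abs_Phi: "\<bar>Phi p a\<bar> = \<bar>a\<bar> powr (p - 1)"
proof (cases "a = 0")
  case False
  then have "\<bar>a\<bar> powr (p - 2) * \<bar>a\<bar> powr 1 = \<bar>a\<bar> powr (p - 1)"
    unfolding powr_add[symmetric] by simp
  then show ?thesis using False by (simp add: Phi_def abs_mult)
qed simp

lemma Phi_nonneg: "a \<ge> 0 \<Longrightarrow> Phi p a = a powr (p - 1)"
  using abs_Phi[of p a] by (simp add: Phi_def)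

lemma Phi_neg: "a \<le> 0 \<Longrightarrow> Phi p a = - ((- a) powr (p - 1))"
  using Phi_nonneg[of "- a" p] by (simp add: Phi_minus)

lemma measurable_Phi [measurable]: "Phi p \<in> borel_measurable borel"
  unfolding Phi_def by measurable

lemma isCont_Phi:
  assumes "p > 1"
  shows "isCont (Phi p) a"
proof (cases "a = 0")
  case True
  have "((\<lambda>t. \<bar>t\<bar> powr (p - 1)) \<longlongrightarrow> \<bar>0\<bar> powr (p - 1)) (at (0::real))"
    using assms by (intro tendsto_powr' tendsto_intros) auto
  then have "((\<lambda>t. \<bar>Phi p t\<bar>) \<longlongrightarrow> 0) (at 0)"
    using assms by (simp add: abs_Phi)
  then show ?thesis
    using True by (simp add: isCont_def tendsto_rabs_zero_iff)
next
  case False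
  then show ?thesis unfolding Phi_def by (intro continuous_intros) auto
qed

text \<open>For \<open>v \<ge> 0\<close> the power lies between 1 and \<open>v\<close>, as the
  exponent \<open>p - 1\<close> is in \<open>(0, 1]\<close>. The factor 2 is for \<open>v\<close> in
  \<open>[-1, 0]\<close>, where the left side is at most 2 and \<open>\<bar>v - 1\<bar>\<close> at
  least 1.\<close>

lemma Phi_diff_1_le:
  assumes "1 < p" "p \<le> 2"
  shows "\<bar>Phi p v - 1\<bar> \<le> 2 * \<bar>v - 1\<bar>"
proof -
  consider "v \<ge> 1" | "0 \<le> v" "v \<le> 1" | "v \<le> 0" "-1 \<le> v" | "v \<le> -1" by linarith
  then show ?thesis
  proof cases
    case 1
    then have "v powr (p - 1) \<le> v powr 1" "1 \<le> v powr (p - 1)"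
      using assms by (intro powr_mono ge_one_powr_ge_zero; simp)+
    then show ?thesis using 1 by (simp add: Phi_nonneg)
  next
    case 2
    then have "v powr 1 \<le> v powr (p - 1)" "v powr (p - 1) \<le> 1"
      using assms by (intro powr_mono' powr_le1; simp)+
    then show ?thesis using 2 by (simp add: Phi_nonneg)
  next
    case 3
    then have "(- v) powr (p - 1) \<le> 1" "0 \<le> (- v) powr (p - 1)"
      using assms by (intro powr_le1; simp) simp
    then have "\<bar>- ((- v) powr (p - 1)) - 1\<bar> \<le> 2"
      unfolding abs_le_iff by linarith
    then show ?thesis using 3 by (simp add: Phi_neg)
  next
    case 4
    then have "(- v) powr (p - 1) \<le> (- v) powr 1" "0 \<le> (- v) powr (p - 1)"
      using assms by (intro powr_mono; simp) simp
    moreover have "(- v) powr 1 = - v" using 4 by simp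
    ultimately have "\<bar>- ((- v) powr (p - 1)) - 1\<bar> \<le> 1 - v"
      unfolding abs_le_iff using 4 by linarith
    then show ?thesis using 4 by (simp add: Phi_neg)
  qed
qed

text \<open>Factoring out \<open>d\<close> leaves \<open>\<bar>Phi p d\<bar> / \<bar>d\<bar> =
  \<bar>d\<bar> powr (p - 2)\<close> as the slope. The increment \<open>x\<close> is arbitrary and
  may carry \<open>d + x\<close> across 0.\<close>

lemma Phi_diff_le_singular:
  assumes "1 < p" "p \<le> 2" "d \<noteq> 0"
  shows "\<bar>Phi p (d + x) - Phi p d\<bar> \<le> 2 * \<bar>d\<bar> powr (p - 2) * \<bar>x\<bar>"
proof -
  have "d + x = d * (1 + x / d)" using assms by (simp add: field_simps)
  then have "Phi p (d + x) - Phi p d = Phi p d * (Phi p (1 + x / d) - 1)"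
    by (simp only: Phi_mult) (simp add: algebra_simps)
  then have "\<bar>Phi p (d + x) - Phi p d\<bar> = \<bar>Phi p d\<bar> * \<bar>Phi p (1 + x / d) - 1\<bar>"
    by (simp add: abs_mult)
  also have "\<dots> \<le> \<bar>Phi p d\<bar> * (2 * \<bar>x / d\<bar>)"
    using Phi_diff_1_le[OF assms(1,2), of "1 + x / d"] by (intro mult_left_mono) auto
  also have "\<dots> = 2 * \<bar>d\<bar> powr (p - 2) * \<bar>x\<bar>"
    using assms(3) by (simp add: Phi_def abs_mult)
  finally show ?thesis .
qed

text \<open>Bernoulli's inequality with the exponent raised to an integer, which for
  \<open>0 < v \<le> 1\<close> only lowers the power. For \<open>v \<le> 0\<close> the power of
  \<open>\<bar>v\<bar>\<close> is at most \<open>\<bar>v\<bar>\<close>, since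
  \<open>p \<ge> 2\<close>.\<close>

lemma one_minus_Phi_le:
  assumes "2 \<le> p" "\<bar>v\<bar> \<le> 1"
  shows "\<bar>1 - Phi p v\<bar> \<le> real (nat \<lceil>p\<rceil>) * \<bar>1 - v\<bar>"
proof (cases "v > 0")
  case True
  define N where "N = nat \<lceil>p\<rceil>"
  have N: "real N \<ge> p - 1" unfolding N_def using assms by linarith
  have "1 + real N * (v - 1) \<le> (1 + (v - 1)) ^ N"
    using True by (intro Bernoulli_inequality) simp
  also have "\<dots> = v powr real N" using True by (simp add: powr_realpow)
  also have "\<dots> \<le> v powr (p - 1)"
    using True assms N by (intro powr_mono') auto
  finally have "1 - Phi p v \<le> real N * (1 - v)"
    using True by (simp add: Phi_nonneg algebra_simps)
  moreover have "v powr (p - 1) \<le> 1" using True assms by (intro powr_le1) auto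
  ultimately show ?thesis
    using True assms by (simp add: Phi_nonneg N_def)
next
  case False
  have "(- v) powr (p - 1) \<le> (- v) powr 1" "0 \<le> (- v) powr (p - 1)"
    using False assms by (intro powr_mono'; simp) simp
  then have "\<bar>1 - Phi p v\<bar> \<le> 1 * \<bar>1 - v\<bar>"
    using False by (simp add: Phi_neg)
  also have "\<dots> \<le> real (nat \<lceil>p\<rceil>) * \<bar>1 - v\<bar>"
    using assms by (intro mult_right_mono) linarith+
  finally show ?thesis .
qed

text \<open>The argument of larger absolute value is factored out; the other becomes a quotient in
  \<open>[-1, 1]\<close>.\<close>

lemma Phi_diff_le:
  assumes "2 \<le> p" "\<bar>a\<bar> \<le> m" "\<bar>b\<bar> \<le> m"
  shows "\<bar>Phi p a - Phi p b\<bar> \<le> real (nat \<lceil>p\<rceil>) * m powr (p - 2) * \<bar>a - b\<bar>"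
proof -
  have *: "\<bar>Phi p a - Phi p b\<bar> \<le> real (nat \<lceil>p\<rceil>) * m powr (p - 2) * \<bar>a - b\<bar>"
    if "\<bar>b\<bar> \<le> \<bar>a\<bar>" "\<bar>a\<bar> \<le> m" for a b
  proof (cases "a = 0")
    case False
    have "b = a * (b / a)" using False by simp
    then have "Phi p a - Phi p b = Phi p a * (1 - Phi p (b / a))"
      by (metis Phi_mult mult.right_neutral right_diff_distrib)
    then have "\<bar>Phi p a - Phi p b\<bar> = \<bar>Phi p a\<bar> * \<bar>1 - Phi p (b / a)\<bar>"
      by (simp add: abs_mult)
    also have "\<dots> \<le> \<bar>Phi p a\<bar> * (real (nat \<lceil>p\<rceil>) * \<bar>1 - b / a\<bar>)"
      using that False by (intro mult_left_mono one_minus_Phi_le assms) auto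
    also have "\<dots> = real (nat \<lceil>p\<rceil>) * \<bar>a\<bar> powr (p - 2) * (\<bar>a\<bar> * \<bar>1 - b / a\<bar>)"
      by (simp add: Phi_def abs_mult)
    also have "\<bar>a\<bar> * \<bar>1 - b / a\<bar> = \<bar>a - b\<bar>"
      using False by (simp add: abs_mult[symmetric] right_diff_distrib)
    also have "real (nat \<lceil>p\<rceil>) * \<bar>a\<bar> powr (p - 2) * \<bar>a - b\<bar> \<le> real (nat \<lceil>p\<rceil>) * m powr (p - 2) * \<bar>a - b\<bar>"
      using that assms by (intro mult_right_mono mult_left_mono powr_mono2) auto
    finally show ?thesis .
  qed (use that in simp)
  show ?thesis
    using *[of a b] *[of b a] assms by (cases "\<bar>b\<bar> \<le> \<bar>a\<bar>") (auto simp: abs_minus_commute)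
qed

section \<open>Second-order Taylor expansion\<close>

text \<open>The norm of \<open>real ^ 'n ^ 'm\<close> is the Frobenius norm, so Cauchy-Schwarz in
  each row suffices.\<close>

lemma norm_matrix_vector_mult_le:
  fixes A :: "real ^ 'n ^ 'm"
  shows "norm (A *v x) \<le> norm A * norm x"
proof -
  have "norm (A *v x) = L2_set (\<lambda>i. norm ((A *v x) $ i)) UNIV"
    by (simp add: norm_vec_def)
  also have "\<dots> \<le> L2_set (\<lambda>i. norm (A $ i) * norm x) UNIV"
    by (intro L2_set_mono) (auto simp: matrix_vector_mul_component Cauchy_Schwarz_ineq2)
  also have "\<dots> = norm A * norm x"
    by (simp add: norm_vec_def L2_set_left_distrib)
  finally show ?thesis .
qed

text \<open>The Lagrange form keeps the Hessian at an intermediate point: its bound controls the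
  remainder for all \<open>z\<close>, and continuity of \<open>H\<close> gives the exact quadratic
  asymptotics along rays.\<close>

lemma C2b_taylor:
  fixes u :: "real ^ 'n \<Rightarrow> real"
  assumes "u \<in> C2b"
  obtains H :: "real ^ 'n \<Rightarrow> real ^ 'n ^ 'n" and K where "K > 0"
    "continuous_on UNIV u" "continuous_on UNIV H"
    "\<And>z. \<bar>u z\<bar> \<le> K" "norm (gradient u x) \<le> K"
    "\<And>z. \<exists>\<xi>\<in>{0..1}. u (x + z) - u x = gradient u x \<bullet> z + 1/2 * (z \<bullet> (H (x + \<xi> *\<^sub>R z) *v z))"
    "\<And>y z. \<bar>z \<bullet> (H y *v z)\<bar> \<le> K * (norm z)\<^sup>2"
proof -
  obtain g :: "real ^ 'n \<Rightarrow> real ^ 'n" and H :: "real ^ 'n \<Rightarrow> real ^ 'n ^ 'n" where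
    g: "\<And>x. GDERIV u x :> g x" and H: "\<And>x. (g has_derivative (\<lambda>h. H x *v h)) (at x)"
    and cH: "continuous_on UNIV H"
    and bd: "bounded (range u)" "bounded (range g)" "bounded (range H)"
    using assms unfolding C2b_def by auto
  \<comment> \<open>\<open>gradient\<close> is a definite description, so uniqueness of the
    derivative is what identifies it with \<open>g\<close>.\<close>
  have grad: "gradient u x = g x" for x
    unfolding gradient_def
  proof (rule the_equality)
    fix g' assume "GDERIV u x :> g'"
    then have "(\<lambda>h. h \<bullet> g') = (\<lambda>h. h \<bullet> g x)"
      using g[of x] unfolding gderiv_def by (rule has_derivative_unique)
    then show "g' = g x" by (metis vector_eq_ldot)
  qed (rule g)
  obtain Ku Kg KH where K: "\<And>z. \<bar>u z\<bar> \<le> Ku" "\<And>z. norm (g z) \<le> Kg" "\<And>z. norm (H z) \<le> KH"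
    using bd unfolding bounded_iff by auto
  define K where "K = max (max Ku Kg) (max KH 1)"
  have taylor: "\<exists>\<xi>\<in>{0..1}. u (x + z) - u x = g x \<bullet> z + 1/2 * (z \<bullet> (H (x + \<xi> *\<^sub>R z) *v z))" for z
  proof -
    \<comment> \<open>The function \<open>u\<close> on the segment from \<open>x\<close> to
      \<open>x + z\<close> and its first two derivatives, indexed by order as
      \<open>Maclaurin2\<close> expects.\<close>
    define \<phi> where "\<phi> m t = (if m = 0 then u (x + t *\<^sub>R z) else if m = 1 then z \<bullet> g (x + t *\<^sub>R z)
       else z \<bullet> (H (x + t *\<^sub>R z) *v z))" for m :: nat and t :: real
    have line: "((\<lambda>t. x + t *\<^sub>R z) has_derivative (\<lambda>s. s *\<^sub>R z)) (at t)" for t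
      by (auto intro!: derivative_eq_intros)
    have d0: "DERIV (\<phi> 0) t :> \<phi> 1 t" for t
    proof -
      have "((\<lambda>t. u (x + t *\<^sub>R z)) has_derivative (\<lambda>s. (s *\<^sub>R z) \<bullet> g (x + t *\<^sub>R z))) (at t)"
        using g[of "x + t *\<^sub>R z"] unfolding gderiv_def
        by (rule has_derivative_compose[OF line])
      then show ?thesis
        unfolding \<phi>_def has_field_derivative_def by (simp add: mult.commute[of _ "z \<bullet> _"])
    qed
    have d1: "DERIV (\<phi> 1) t :> \<phi> (Suc 1) t" for t
    proof -
      have "((\<lambda>t. z \<bullet> g (x + t *\<^sub>R z)) has_derivative (\<lambda>s. z \<bullet> (H (x + t *\<^sub>R z) *v (s *\<^sub>R z)))) (at t)"
        by (intro has_derivative_inner_right has_derivative_compose[OF line H])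
      then show ?thesis
        unfolding \<phi>_def has_field_derivative_def
        by (simp add: matrix_vector_mult_scaleR mult.commute[of _ "z \<bullet> _"])
    qed
    have "\<exists>t. 0 < t \<and> t \<le> 1 \<and> \<phi> 0 1 = (\<Sum>m<2. \<phi> m 0 / fact m * 1 ^ m) + \<phi> 2 t / fact 2 * 1 ^ 2"
    proof (rule Maclaurin2)
      show "\<forall>m t. m < 2 \<and> 0 \<le> t \<and> t \<le> 1 \<longrightarrow> DERIV (\<phi> m) t :> \<phi> (Suc m) t"
        using d0 d1 by (auto simp: less_2_cases_iff)
    qed auto
    then obtain t where "0 < t" "t \<le> 1" "u (x + z) = u x + z \<bullet> g x + (z \<bullet> (H (x + t *\<^sub>R z) *v z)) / 2"
      by (auto simp: \<phi>_def numeral_2_eq_2)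
    then show ?thesis by (intro bexI[of _ t]) (auto simp: inner_commute)
  qed
  have "\<bar>z \<bullet> (H y *v z)\<bar> \<le> K * (norm z)\<^sup>2" for y z
  proof -
    have "\<bar>z \<bullet> (H y *v z)\<bar> \<le> norm z * norm (H y *v z)" by (rule Cauchy_Schwarz_ineq2)
    also have "\<dots> \<le> norm z * (K * norm z)"
    proof (intro mult_left_mono)
      have "norm (H y *v z) \<le> norm (H y) * norm z" by (rule norm_matrix_vector_mult_le)
      also have "\<dots> \<le> K * norm z"
        using K(3)[of y] by (intro mult_right_mono) (auto simp: K_def)
      finally show "norm (H y *v z) \<le> K * norm z" .
    qed auto
    finally show ?thesis by (simp add: power2_eq_square mult_ac)
  qed
  moreover have "continuous_on UNIV u"
    using g unfolding gderiv_def
    by (intro continuous_at_imp_continuous_on) (auto intro: has_derivative_continuous)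
  moreover have "\<bar>u z\<bar> \<le> K" "norm (gradient u x) \<le> K" for z
    using K(1)[of z] K(2)[of x] by (auto simp: K_def grad)
  ultimately show thesis
    using that[of K H] cH taylor by (simp add: grad K_def)
qed

subsection \<open>The fractional p-Laplacian\<close>

lemma pv_trunc_frac_kernel:
  fixes u :: "real ^ 'n \<Rightarrow> real"
  assumes [measurable]: "u \<in> borel_measurable borel"
  shows "pv_trunc (frac_kernel s p u x) x \<epsilon> =
    (\<integral>z. indicator {z. norm z > \<epsilon>} z * (Phi p (u x - u (x + z)) / norm z powr (real CARD('n) + s * p)) \<partial>lborel)"
proof -
  have "pv_trunc (frac_kernel s p u x) x \<epsilon> =
     (\<integral>y. indicator {y. norm (x - y) > \<epsilon>} y * (Phi p (u x - u y) / norm (x - y) powr (real CARD('n) + s * p)) \<partial>lborel)"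
    by (simp add: pv_trunc_def set_lebesgue_integral_def frac_kernel_def)
  also have "\<dots> = (\<integral>z. indicator {y. norm (x - y) > \<epsilon>} (x + z) *
      (Phi p (u x - u (x + z)) / norm (x - (x + z)) powr (real CARD('n) + s * p)) \<partial>lborel)"
    by (rule integral_lborel_translate[symmetric]) measurable
  also have "\<dots> = (\<integral>z. indicator {z. norm z > \<epsilon>} z * (Phi p (u x - u (x + z)) / norm z powr (real CARD('n) + s * p)) \<partial>lborel)"
    by (intro Bochner_Integration.integral_cong) (auto split: split_indicator)
  finally show ?thesis .
qed

text \<open>The exponents \<open>- n / 2\<close> of the heat kernel and \<open>- 1 - s p / 2\<close>
  of the time measure add up to that of \<open>heat_weight\<close>.\<close>

lemma semigroup_integrand_eq:
  fixes u :: "real ^ 'n \<Rightarrow> real"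
  assumes [measurable]: "u \<in> borel_measurable borel" and "t > 0"
  shows "semigroup_integrand s p u x t = (4 * pi) powr (- (real CARD('n) / 2)) *
    (\<integral>z. Phi p (u x - u (x + z)) * heat_weight ((real CARD('n) + s * p) / 2) (norm z) t \<partial>lborel)"
proof -
  let ?n = "real CARD('n)"
  have "(\<integral>y. exp (- (norm (x - y))\<^sup>2 / (4 * t)) * Phi p (u x - u y) \<partial>lborel) =
     (\<integral>z. exp (- (norm (x - (x + z)))\<^sup>2 / (4 * t)) * Phi p (u x - u (x + z)) \<partial>lborel)"
    by (rule integral_lborel_translate[symmetric]) measurable
  then have 1: "semigroup_integrand s p u x t =
    1 / (4 * pi * t) powr (?n / 2) / t powr (1 + s * p / 2) *
      (\<integral>z. exp (- (norm z)\<^sup>2 / (4 * t)) * Phi p (u x - u (x + z)) \<partial>lborel)"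
    by (simp add: semigroup_integrand_def heat_semigroup_def)
  have 2: "1 / (4 * pi * t) powr (?n / 2) / t powr (1 + s * p / 2) =
      (4 * pi) powr (- (?n / 2)) * t powr (- 1 - (?n + s * p) / 2)"
  proof -
    have "- 1 - (?n + s * p) / 2 = - (?n / 2) + - (1 + s * p / 2)"
      by (simp add: field_simps)
    then have "t powr (- 1 - (?n + s * p) / 2) = t powr (- (?n / 2) + - (1 + s * p / 2))"
      by (simp only:)
    also have "\<dots> = 1 / t powr (?n / 2) * (1 / t powr (1 + s * p / 2))"
      by (simp only: powr_add powr_minus_divide)
    finally show ?thesis
      using \<open>t > 0\<close> by (simp only: powr_mult powr_minus_divide) simp
  qed
  have 3: "(\<integral>z. Phi p (u x - u (x + z)) * heat_weight ((?n + s * p) / 2) (norm z) t \<partial>lborel) =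
      t powr (- 1 - (?n + s * p) / 2) * (\<integral>z. exp (- (norm z)\<^sup>2 / (4 * t)) * Phi p (u x - u (x + z)) \<partial>lborel)"
    unfolding heat_weight_def
    by (subst integral_mult_right_zero[symmetric]) (simp only: mult_ac)
  show ?thesis
    unfolding 1 2 3 by (simp only: mult.assoc)
qed

text \<open>The origin of \<open>C2\<close>: it undoes the factor
  \<open>(4 pi) powr (- n / 2)\<close> of the heat kernel and the constant of the time integral,
  whose \<open>4 powr \<beta>\<close> splits into \<open>4 powr (n / 2)\<close> and
  \<open>2 powr (s p)\<close>.\<close>

lemma C2_normalisation:
  assumes "(real n + s * p) / 2 > 0"
  shows "C2 C1 n s p * (4 * pi) powr (- (real n / 2)) =
     C1 n s p / (4 powr ((real n + s * p) / 2) * Gamma ((real n + s * p) / 2))"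
proof -
  have "(4::real) powr (s * p / 2) = (4 powr (1/2)) powr (s * p)"
    by (simp only: powr_powr) (simp add: mult.commute)
  also have "(4::real) powr (1/2) = 2"
    using real_sqrt_unique[of 2 4] by (simp add: powr_half_sqrt)
  finally have "(4::real) powr ((real n + s * p) / 2) = 4 powr (real n / 2) * 2 powr (s * p)"
    by (simp add: add_divide_distrib powr_add)
  moreover have "(4 * pi) powr (- (real n / 2)) = 1 / (4 powr (real n / 2) * pi powr (real n / 2))"
    by (simp add: powr_minus_divide powr_mult)
  ultimately show ?thesis
    by (simp add: C2_def)
qed

text \<open>Restores the constants. Both truncations then have the same finite limit,
  \<open>C1\<close> times \<open>I\<close>, and \<open>extended_identity\<close> follows by
  uniqueness of limits.\<close>

lemma frac_p_laplacian_formula_finite: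
  fixes u :: "real ^ 'n \<Rightarrow> real"
  assumes sp: "s * p > 0" and [measurable]: "u \<in> borel_measurable borel"
    and I: "((\<lambda>\<epsilon>. \<integral>z. indicator {z. norm z > \<epsilon>} z *
        (Phi p (u x - u (x + z)) / norm z powr (real CARD('n) + s * p)) \<partial>lborel) \<longlongrightarrow> I) (at_right 0)"
    and int: "set_integrable lborel {0<..}
        (\<lambda>t. \<integral>z. Phi p (u x - u (x + z)) * heat_weight ((real CARD('n) + s * p) / 2) (norm z) t \<partial>lborel)"
    and eq: "(LINT t:{0<..}|lborel. \<integral>z. Phi p (u x - u (x + z)) * heat_weight ((real CARD('n) + s * p) / 2) (norm z) t \<partial>lborel)
       = 4 powr ((real CARD('n) + s * p) / 2) * Gamma ((real CARD('n) + s * p) / 2) * I"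
  shows "pv_exists (frac_kernel s p u x) x"
    and "set_integrable lborel {0<..} (semigroup_integrand s p u x)"
    and "frac_p_laplacian C1 s p u x =
             C2 C1 CARD('n) s p * (LINT t:{0<..}|lborel. semigroup_integrand s p u x t)"
    and "extended_identity C1 s p u x"
proof -
  let ?\<beta> = "(real CARD('n) + s * p) / 2"
  let ?e = "\<lambda>t. \<integral>z. Phi p (u x - u (x + z)) * heat_weight ?\<beta> (norm z) t \<partial>lborel"
  have \<beta>: "?\<beta> > 0" using sp by (intro divide_pos_pos add_nonneg_pos) auto
  have A: "4 powr ?\<beta> * Gamma ?\<beta> > 0" using \<beta> by (intro mult_pos_pos Gamma_real_pos) auto
  have pv: "(pv_trunc (frac_kernel s p u x) x \<longlongrightarrow> I) (at_right 0)"
    using I by (subst ext[OF pv_trunc_frac_kernel]) auto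
  then show "pv_exists (frac_kernel s p u x) x" unfolding pv_exists_def by blast
  have lap: "frac_p_laplacian C1 s p u x = C1 CARD('n) s p * I"
    unfolding frac_p_laplacian_def pv_integral_def using tendsto_Lim[OF _ pv] by simp
  have "set_integrable lborel {0<..} (\<lambda>t. (4 * pi) powr (- (real CARD('n) / 2)) * ?e t)"
    using int by (rule set_integrable_mult_right)
  then show int': "set_integrable lborel {0<..} (semigroup_integrand s p u x)"
    by (subst set_integrable_cong[OF refl refl semigroup_integrand_eq]) auto
  have "(LINT t:{0<..}|lborel. semigroup_integrand s p u x t) =
      (LINT t:{0<..}|lborel. (4 * pi) powr (- (real CARD('n) / 2)) * ?e t)"
    by (intro set_lebesgue_integral_cong) (auto simp: semigroup_integrand_eq)
  also have "\<dots> = (4 * pi) powr (- (real CARD('n) / 2)) * (4 powr ?\<beta> * Gamma ?\<beta> * I)"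
    by (simp only: set_integral_mult_right eq)
  finally have "C2 C1 CARD('n) s p * (LINT t:{0<..}|lborel. semigroup_integrand s p u x t) =
     (C2 C1 CARD('n) s p * (4 * pi) powr (- (real CARD('n) / 2))) * (4 powr ?\<beta> * Gamma ?\<beta>) * I"
    by (simp only: mult.assoc)
  also have "\<dots> = C1 CARD('n) s p * I"
    unfolding C2_normalisation[OF \<beta>] using Gamma_real_pos[OF \<beta>] by simp
  finally have heat: "C2 C1 CARD('n) s p * (LINT t:{0<..}|lborel. semigroup_integrand s p u x t) = C1 CARD('n) s p * I" .
  then show "frac_p_laplacian C1 s p u x =
             C2 C1 CARD('n) s p * (LINT t:{0<..}|lborel. semigroup_integrand s p u x t)"
    using lap by simp
  have "((\<lambda>\<epsilon>. ereal (C1 CARD('n) s p * pv_trunc (frac_kernel s p u x) x \<epsilon>)) \<longlongrightarrow> ereal (C1 CARD('n) s p * I)) (at_right 0)"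
    by (intro tendsto_intros pv)
  moreover have "((\<lambda>\<delta>. ereal (C2 C1 CARD('n) s p * (LINT t:{\<delta><..}|lborel. semigroup_integrand s p u x t)))
           \<longlongrightarrow> ereal (C1 CARD('n) s p * I)) (at_right 0)"
    unfolding heat[symmetric] by (intro tendsto_intros tail_integral_tendsto int')
  ultimately show "extended_identity C1 s p u x"
    unfolding extended_identity_def by (metis tendsto_unique trivial_limit_at_right_real)
qed

text \<open>The sign of \<open>c\<close> decides. For \<open>c = 0\<close> the two truncations
  differ by a null function; otherwise the heat integral diverges logarithmically with the sign of
  \<open>c\<close>, and the singular integral follows it at bounded distance.\<close>

lemma extended_identity_critical:
  fixes u :: "real ^ 'n \<Rightarrow> real"
  assumes sp: "s * p > 0" and C1: "C1 CARD('n) s p > 0" and [measurable]: "u \<in> borel_measurable borel"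
    and bnd: "\<And>z. \<bar>Phi p (u x - u (x + z))\<bar> \<le> B"
    and D: "((\<lambda>\<delta>. (LINT t:{\<delta><..}|lborel. \<integral>z. Phi p (u x - u (x + z)) * heat_weight ((real CARD('n) + s * p) / 2) (norm z) t \<partial>lborel) -
        4 powr ((real CARD('n) + s * p) / 2) * Gamma ((real CARD('n) + s * p) / 2) *
        (\<integral>z. indicator {z. norm z > sqrt \<delta>} z * (Phi p (u x - u (x + z)) / norm z powr (real CARD('n) + s * p)) \<partial>lborel))
        \<longlongrightarrow> D) (at_right 0)"
    and c: "((\<lambda>t. t * (\<integral>z. Phi p (u x - u (x + z)) * heat_weight ((real CARD('n) + s * p) / 2) (norm z) t \<partial>lborel)) \<longlongrightarrow> c) (at_right 0)"
    and cD: "c = 0 \<Longrightarrow> D = 0"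
  shows "extended_identity C1 s p u x"
proof -
  let ?\<beta> = "(real CARD('n) + s * p) / 2"
  let ?e = "\<lambda>t. \<integral>z. Phi p (u x - u (x + z)) * heat_weight ?\<beta> (norm z) t \<partial>lborel"
  have \<beta>: "?\<beta> > 0" using sp by (intro divide_pos_pos add_nonneg_pos) auto
  have A: "4 powr ?\<beta> * Gamma ?\<beta> > 0" using \<beta> by (intro mult_pos_pos Gamma_real_pos) auto
  \<comment> \<open>\<open>R\<close> turns the heat integral into \<open>b\<close> and the constant
    of the time integral into \<open>C1\<close>, so the convergent difference only has to be
    multiplied by \<open>R\<close>.\<close>
  define R where "R = C1 CARD('n) s p / (4 powr ?\<beta> * Gamma ?\<beta>)"
  have "X / Y * Y = X" if "Y > 0" for X Y :: real using that by simp
  then have R: "R > 0" "R * (4 powr ?\<beta> * Gamma ?\<beta>) = C1 CARD('n) s p"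
    unfolding R_def using A C1 by (blast intro: divide_pos_pos)+
  define a where "a \<epsilon> = C1 CARD('n) s p * pv_trunc (frac_kernel s p u x) x \<epsilon>" for \<epsilon>
  define b where "b \<delta> = C2 C1 CARD('n) s p * (LINT t:{\<delta><..}|lborel. semigroup_integrand s p u x t)" for \<delta>
  have b: "b \<delta> = R * (LINT t:{\<delta><..}|lborel. ?e t)" if "\<delta> > 0" for \<delta>
  proof -
    have "(LINT t:{\<delta><..}|lborel. semigroup_integrand s p u x t) =
      (LINT t:{\<delta><..}|lborel. (4 * pi) powr (- (real CARD('n) / 2)) * ?e t)"
      using that by (intro set_lebesgue_integral_cong) (auto simp: semigroup_integrand_eq)
    also have "\<dots> = (4 * pi) powr (- (real CARD('n) / 2)) * (LINT t:{\<delta><..}|lborel. ?e t)"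
      by (rule set_integral_mult_right)
    finally have "b \<delta> = (C2 C1 CARD('n) s p * (4 * pi) powr (- (real CARD('n) / 2))) * (LINT t:{\<delta><..}|lborel. ?e t)"
      by (simp only: b_def mult.assoc)
    then show ?thesis by (simp only: C2_normalisation[OF \<beta>] R_def)
  qed
  have pos: "\<forall>\<^sub>F \<delta> in at_right 0. (0::real) < \<delta>" by (rule eventually_at_right_less)
  have lim: "((\<lambda>\<delta>. b \<delta> - a (sqrt \<delta>)) \<longlongrightarrow> R * D) (at_right 0)"
  proof (rule Lim_transform_eventually[OF tendsto_mult[OF tendsto_const[of R] D]])
    show "\<forall>\<^sub>F \<delta> in at_right 0. R * ((LINT t:{\<delta><..}|lborel. ?e t) - 4 powr ?\<beta> * Gamma ?\<beta> *
        (\<integral>z. indicator {z. norm z > sqrt \<delta>} z * (Phi p (u x - u (x + z)) / norm z powr (real CARD('n) + s * p)) \<partial>lborel))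
        = b \<delta> - a (sqrt \<delta>)"
      using pos
    proof eventually_elim
      case (elim \<delta>)
      show ?case
        unfolding a_def b[OF elim] pv_trunc_frac_kernel[OF \<open>u \<in> _\<close>] R(2)[symmetric]
        by (simp only: right_diff_distrib mult.assoc)
    qed
  qed
  have meas: "(\<lambda>z. Phi p (u x - u (x + z))) \<in> borel_measurable borel" by measurable
  have int: "set_integrable lborel {\<delta><..} ?e" if "\<delta> > 0" for \<delta>
    using heat_fubini(2)[OF meas heat_finite_bounded[OF meas bnd that sp]] by simp
  have "R * D = 0 \<or> filterlim b at_top (at_right 0) \<or> filterlim b at_bot (at_right 0)"
  proof -
    consider "c = 0" | "c > 0" | "c < 0" by linarith
    then show ?thesis
    proof cases
      case 2
      have "filterlim (\<lambda>\<delta>. R * (LINT t:{\<delta><..}|lborel. ?e t)) at_top (at_right 0)"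
        using R(1) tail_integral_at_top[OF int c 2]
        by (intro filterlim_tendsto_pos_mult_at_top[OF tendsto_const])
      then have "filterlim b at_top (at_right 0)"
        by (rule filterlim_mono_eventually[OF _ order.refl order.refl])
           (use pos in eventually_elim, simp add: b)
      then show ?thesis by blast
    next
      case 3
      have "((\<lambda>t. t * - ?e t) \<longlongrightarrow> - c) (at_right 0)"
        using tendsto_minus[OF c] by simp
      from tail_integral_at_top[OF _ this] 3 int
      have "filterlim (\<lambda>\<delta>. LINT t:{\<delta><..}|lborel. - ?e t) at_top (at_right 0)"
        by (simp add: set_integrable_def)
      then have "filterlim (\<lambda>\<delta>. R * - (LINT t:{\<delta><..}|lborel. ?e t)) at_top (at_right 0)"
        using R(1) by (intro filterlim_tendsto_pos_mult_at_top[OF tendsto_const])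
          (simp_all add: set_lebesgue_integral_def)
      then have "filterlim (\<lambda>\<delta>. R * (LINT t:{\<delta><..}|lborel. ?e t)) at_bot (at_right 0)"
        by (simp add: filterlim_uminus_at_bot)
      then have "filterlim b at_bot (at_right 0)"
        by (rule filterlim_mono_eventually[OF _ order.refl order.refl])
           (use pos in eventually_elim, simp add: b)
      then show ?thesis by blast
    qed (use cD in simp)
  qed
  then show ?thesis
    unfolding extended_identity_def a_def[symmetric] b_def[symmetric]
    using extended_limit_iff[OF lim] by blast
qed

section \<open>The four regimes of \<open>p\<close> and the gradient\<close>

theorem theorem2p1:
  fixes s p :: real
    and C1 :: "nat \<Rightarrow> real \<Rightarrow> real \<Rightarrow> real"
    and u :: "real ^ 'n \<Rightarrow> real"
    and x0 :: "real ^ 'n"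
  assumes "0 < s" and "s < 1" and "1 < p"
    and "C1 CARD('n) s p > 0"
    and "u \<in> C2b"
    and "p < 2 / (2 - s) \<Longrightarrow> gradient u x0 \<noteq> 0"
  shows "((p = 2 / (2 - s) \<longrightarrow> gradient u x0 \<noteq> 0) \<longrightarrow>
           pv_exists (frac_kernel s p u x0) x0 \<and>
           set_integrable lborel {0<..} (semigroup_integrand s p u x0) \<and>
           frac_p_laplacian C1 s p u x0 =
             C2 C1 CARD('n) s p * (LINT t:{0<..}|lborel. semigroup_integrand s p u x0 t)) \<and>
         extended_identity C1 s p u x0"
proof -
  define e where "e = gradient u x0"
  obtain H :: "real ^ 'n \<Rightarrow> real ^ 'n ^ 'n" and K where K: "K > 0"
    and cu: "continuous_on UNIV u" and cH: "continuous_on UNIV H"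
    and uK: "\<And>z. \<bar>u z\<bar> \<le> K" and eK: "norm e \<le> K"
    and taylor: "\<And>z. \<exists>\<xi>\<in>{0..1}. u (x0 + z) - u x0 = e \<bullet> z + 1/2 * (z \<bullet> (H (x0 + \<xi> *\<^sub>R z) *v z))"
    and HK: "\<And>y z. \<bar>z \<bullet> (H y *v z)\<bar> \<le> K * (norm z)\<^sup>2"
    using C2b_taylor[OF assms(5), of x0] unfolding e_def by metis
  have um [measurable]: "u \<in> borel_measurable borel"
    using cu by (rule borel_measurable_continuous_onI)
  define f where "f z = Phi p (u x0 - u (x0 + z))" for z
  have fm [measurable]: "f \<in> borel_measurable borel" unfolding f_def by measurable
  have sp: "s * p > 0" using assms by simp
  define B where "B = (2 * K) powr (p - 1)"
  have bnd: "\<bar>f z\<bar> \<le> B" for z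
    unfolding f_def abs_Phi B_def
    using uK[of x0] uK[of "x0 + z"] assms(3) by (intro powr_mono2) auto
  have t2: "\<bar>u (x0 + z) - u x0 - e \<bullet> z\<bar> \<le> K * (norm z)\<^sup>2" for z
  proof -
    obtain \<xi> where "u (x0 + z) - u x0 = e \<bullet> z + 1/2 * (z \<bullet> (H (x0 + \<xi> *\<^sub>R z) *v z))"
      using taylor[of z] by blast
    then have "\<bar>u (x0 + z) - u x0 - e \<bullet> z\<bar> \<le> 1/2 * (K * (norm z)\<^sup>2)"
      using HK[of z "x0 + \<xi> *\<^sub>R z"] by (simp add: abs_mult)
    also have "\<dots> \<le> K * (norm z)\<^sup>2" using K by simp
    finally show ?thesis .
  qed
  define S where "S z = (f z + f (- z)) / 2" for z
  \<comment> \<open>Common to the three convergent regimes: each has only to supply a homogeneous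
    majorant of the even part, of degree above \<open>s * p\<close>.\<close>
  have finite_case: "(((p = 2 / (2 - s) \<longrightarrow> gradient u x0 \<noteq> 0) \<longrightarrow>
           pv_exists (frac_kernel s p u x0) x0 \<and>
           set_integrable lborel {0<..} (semigroup_integrand s p u x0) \<and>
           frac_p_laplacian C1 s p u x0 =
             C2 C1 CARD('n) s p * (LINT t:{0<..}|lborel. semigroup_integrand s p u x0 t)) \<and>
         extended_identity C1 s p u x0)"
    if "h \<in> borel_measurable borel" "\<gamma> > s * p"
      and "\<And>c z. c > 0 \<Longrightarrow> h (c *\<^sub>R z) = c powr \<gamma> * h z"
      and "AE z in lborel. \<bar>S z\<bar> \<le> h z"
      and "integrable lborel (\<lambda>z. h z * exp (- (1/4) * (norm z)\<^sup>2))" for h :: "real ^ 'n \<Rightarrow> real" and \<gamma>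
  proof -
    note hyps = that
    obtain I where I:
      "((\<lambda>\<epsilon>. \<integral>z. indicator {z. norm z > \<epsilon>} z * (f z / norm z powr (real DIM(real^'n) + s * p)) \<partial>lborel) \<longlongrightarrow> I) (at_right 0)"
      "set_integrable lborel {0<..} (\<lambda>t. \<integral>z. f z * heat_weight ((real DIM(real^'n) + s * p) / 2) (norm z) t \<partial>lborel)"
      "(LINT t:{0<..}|lborel. \<integral>z. f z * heat_weight ((real DIM(real^'n) + s * p) / 2) (norm z) t \<partial>lborel)
         = 4 powr ((real DIM(real^'n) + s * p) / 2) * Gamma ((real DIM(real^'n) + s * p) / 2) * I"
    proof (rule heat_pv_symmetrized[OF fm hyps(1) bnd sp hyps(2)], goal_cases)
      case (1 c z)
      show ?case by (rule hyps(3)) (rule 1(2))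
    next
      case 2
      show ?case using hyps(4) by (simp add: S_def)
    next
      case 3
      show ?case by (rule hyps(5))
    next
      case (4 I)
      show ?case by (rule 4(1)) (rule 4(2-4))+
    qed
    note I' = I[unfolded f_def, simplified DIM_cart DIM_real mult_1_right]
    show ?thesis
      using frac_p_laplacian_formula_finite[OF sp um I'] by blast
  qed
  have sq_powr: "(K * (norm w)\<^sup>2) powr (p - 1) = K powr (p - 1) * norm w powr (2 * (p - 1))" for w :: "real ^ 'n"
  proof -
    have "(norm w)\<^sup>2 powr (p - 1) = (norm w powr 2) powr (p - 1)" by simp
    then show ?thesis by (simp only: powr_mult powr_powr)
  qed
  have flat: "\<bar>f z\<bar> \<le> K powr (p - 1) * norm z powr (2 * (p - 1))" if "e = 0" for z
    unfolding f_def abs_Phi sq_powr[symmetric]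
    using that t2[of z] assms(3) by (intro powr_mono2) auto
  \<comment> \<open>Since \<open>Phi p\<close> is odd, the even part is half a difference of values
    at two arguments that both equal \<open>- (e \<bullet> z)\<close> up to second order. This is
    the cancellation behind the estimates for \<open>p \<ge> 2\<close> and for nonzero
    gradient.\<close>
  have odd_diff: "S z = (Phi p (u x0 - u (x0 + z)) - Phi p (u (x0 - z) - u x0)) / 2" for z
    using Phi_minus[of p "u (x0 - z) - u x0"] by (simp add: S_def f_def)
  have spp: "s * p < p" using mult_strict_right_mono[of s 1 p] assms by simp
  \<comment> \<open>Exhaustive because the assumption excludes \<open>e = 0\<close> below
    \<open>2 / (2 - s)\<close>.\<close>
  consider "p \<ge> 2" | "p < 2" "e \<noteq> 0" | "p < 2" "e = 0" "p > 2 / (2 - s)" | "p < 2" "e = 0" "p = 2 / (2 - s)"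
    using assms(6) unfolding e_def by linarith
  then show ?thesis
  proof cases
    case 1
    \<comment> \<open>Lipschitz constant of \<open>Phi p\<close> for arguments of size
      \<open>2 * K * norm z\<close>, times their distance, at most
      \<open>2 * K * (norm z)\<^sup>2\<close>, halved.\<close>
    define C where "C = real (nat \<lceil>p\<rceil>) * (2 * K) powr (p - 2) * K"
    \<comment> \<open>Taylor in the unit ball and boundedness outside combine to a linear bound for
      all \<open>z\<close>, as a homogeneous majorant demands.\<close>
    have lip: "\<bar>u (x0 + z) - u x0\<bar> \<le> 2 * K * norm z" for z
    proof (cases "norm z \<le> 1")
      case True
      have "\<bar>e \<bullet> z\<bar> \<le> norm e * norm z" by (rule Cauchy_Schwarz_ineq2)
      also have "\<dots> \<le> K * norm z" using eK by (rule mult_right_mono) simp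
      finally have "\<bar>e \<bullet> z\<bar> \<le> K * norm z" .
      moreover have "K * (norm z)\<^sup>2 \<le> K * norm z"
        using True K by (intro mult_left_mono) (auto simp: power2_eq_square mult_left_le)
      ultimately show ?thesis using t2[of z] by linarith
    next
      case False
      then have "2 * K * 1 \<le> 2 * K * norm z" using K by (intro mult_left_mono) auto
      then show ?thesis using uK[of x0] uK[of "x0 + z"] by linarith
    qed
    show ?thesis
    proof (rule finite_case[of "\<lambda>z. C * norm z powr p" p])
      show "AE z in lborel. \<bar>S z\<bar> \<le> C * norm z powr p"
      proof (intro AE_I2)
        fix z
        let ?a = "u x0 - u (x0 + z)" and ?b = "u (x0 - z) - u x0"
        have A: "\<bar>?a - ?b\<bar> \<le> 2 * (K * (norm z)\<^sup>2)"
          using t2[of z] t2[of "- z"] by simp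
        have P: "\<bar>Phi p ?a - Phi p ?b\<bar> \<le> real (nat \<lceil>p\<rceil>) * (2 * K * norm z) powr (p - 2) * \<bar>?a - ?b\<bar>"
          using 1 lip[of z] lip[of "- z"] by (intro Phi_diff_le) (auto simp: abs_minus_commute)
        have "\<bar>Phi p ?a - Phi p ?b\<bar> \<le> real (nat \<lceil>p\<rceil>) * (2 * K * norm z) powr (p - 2) * (2 * (K * (norm z)\<^sup>2))"
          by (rule order.trans[OF P mult_left_mono[OF A]]) simp
        also have "\<dots> = 2 * C * (norm z powr (p - 2) * norm z powr 2)"
          using K by (simp add: C_def powr_mult)
        also have "norm z powr (p - 2) * norm z powr 2 = norm z powr p"
          unfolding powr_add[symmetric] by simp
        finally show "\<bar>S z\<bar> \<le> C * norm z powr p"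
          unfolding odd_diff by simp
      qed
      show "integrable lborel (\<lambda>z::real^'n. C * norm z powr p * exp (- (1/4) * (norm z)\<^sup>2))"
        unfolding mult.assoc using 1 by (intro integrable_mult_right integrable_powr_gaussian) auto
    qed (auto simp: powr_mult spp)
  next
    case 2
    have tri: "\<bar>(a - b) / 2\<bar> \<le> R" if "\<bar>a - d\<bar> \<le> R" "\<bar>b - d\<bar> \<le> R" for a b d R :: real
    proof -
      have "(a - b) / 2 = ((a - d) - (b - d)) / 2" by simp
      then show ?thesis using that by (simp add: abs_le_iff)
    qed
    \<comment> \<open>The arguments lie within \<open>K * (norm z)\<^sup>2\<close> of
      \<open>- (e \<bullet> z)\<close>, where \<open>Phi p\<close> has slope of size
      \<open>\<bar>e \<bullet> z\<bar> powr (p - 2)\<close>; the degree is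
      \<open>2 + (p - 2) = p\<close>.\<close>
    let ?h = "\<lambda>z. K * (norm z)\<^sup>2 * \<bar>e \<bullet> z\<bar> powr (p - 2) * 2"
    show ?thesis
    proof (rule finite_case[of ?h p])
      have "e \<bullet> z \<noteq> 0 \<longrightarrow> \<bar>S z\<bar> \<le> ?h z" for z
      proof
        assume ez: "e \<bullet> z \<noteq> 0"
        let ?d = "- (e \<bullet> z)"
        have P: "\<bar>Phi p (?d + x) - Phi p ?d\<bar> \<le> 2 * \<bar>e \<bullet> z\<bar> powr (p - 2) * (K * (norm z)\<^sup>2)"
          if "\<bar>x\<bar> \<le> K * (norm z)\<^sup>2" for x
        proof -
          have "\<bar>Phi p (?d + x) - Phi p ?d\<bar> \<le> 2 * \<bar>?d\<bar> powr (p - 2) * \<bar>x\<bar>"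
            using 2 ez assms by (intro Phi_diff_le_singular) auto
          also have "\<dots> \<le> 2 * \<bar>?d\<bar> powr (p - 2) * (K * (norm z)\<^sup>2)"
            using that by (intro mult_left_mono) auto
          finally show ?thesis by simp
        qed
        have "\<bar>Phi p (u x0 - u (x0 + z)) - Phi p ?d\<bar> \<le> 2 * \<bar>e \<bullet> z\<bar> powr (p - 2) * (K * (norm z)\<^sup>2)"
          using P[of "u x0 - u (x0 + z) + e \<bullet> z"] t2[of z] by (simp add: abs_minus_commute algebra_simps)
        moreover have "\<bar>Phi p (u (x0 - z) - u x0) - Phi p ?d\<bar> \<le> 2 * \<bar>e \<bullet> z\<bar> powr (p - 2) * (K * (norm z)\<^sup>2)"
          using P[of "u (x0 - z) - u x0 + e \<bullet> z"] t2[of "- z"] by (simp add: algebra_simps)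
        ultimately have "\<bar>S z\<bar> \<le> 2 * \<bar>e \<bullet> z\<bar> powr (p - 2) * (K * (norm z)\<^sup>2)"
          unfolding odd_diff by (rule tri)
        then show "\<bar>S z\<bar> \<le> ?h z" by (simp add: mult_ac)
      qed
      \<comment> \<open>On this hyperplane \<open>0 powr (p - 2) = 0\<close> makes \<open>?h\<close>
        vanish, so the estimate is established off it.\<close>
      moreover have "AE z in lborel. e \<bullet> z \<noteq> 0"
      proof -
        have "negligible {z. e \<bullet> z = 0}" using 2 by (intro negligible_hyperplane) auto
        then have "{z. e \<bullet> z = 0} \<in> null_sets lborel"
          by (simp add: negligible_iff_null_sets null_sets_completion_iff)
        then show ?thesis by (intro AE_I') auto
      qed
      ultimately show "AE z in lborel. \<bar>S z\<bar> \<le> ?h z"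
        by (auto elim!: eventually_mono)
      show "?h (c *\<^sub>R z) = c powr p * ?h z" if "c > 0" for c z
      proof -
        have "c powr p = c powr 2 * c powr (p - 2)" unfolding powr_add[symmetric] by simp
        then show ?thesis using that by (simp add: abs_mult powr_mult power_mult_distrib mult_ac)
      qed
      \<comment> \<open>Half of the Gaussian absorbs \<open>(norm z)\<^sup>2\<close>; the remaining
        weight has exponent \<open>p - 2\<close> in \<open>(-1, 0)\<close>.\<close>
      show "integrable lborel (\<lambda>z. ?h z * exp (- (1/4) * (norm z)\<^sup>2))"
      proof (rule Bochner_Integration.integrable_bound)
        show "integrable lborel (\<lambda>z. (2 * K * exp (2\<^sup>2 / (2 * (1/4)))) * (\<bar>e \<bullet> z\<bar> powr (p - 2) * exp (- (1/8) * (norm z)\<^sup>2)))"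
          using 2 assms by (intro integrable_mult_right integrable_inner_powr_gaussian) auto
        show "AE z in lborel. norm (?h z * exp (- (1/4) * (norm z)\<^sup>2)) \<le>
          norm ((2 * K * exp (2\<^sup>2 / (2 * (1/4)))) * (\<bar>e \<bullet> z\<bar> powr (p - 2) * exp (- (1/8) * (norm z)\<^sup>2)))"
        proof (intro AE_I2)
          fix z :: "real ^ 'n"
          have "(norm z) powr 2 * exp (- (1/4) * (norm z)\<^sup>2) \<le> exp (2\<^sup>2 / (2 * (1/4))) * exp (- (1/4/2) * (norm z)\<^sup>2)"
            by (rule powr_gaussian_le) auto
          then have "(norm z)\<^sup>2 * exp (- (1/4) * (norm z)\<^sup>2) \<le> exp (2\<^sup>2 / (2 * (1/4))) * exp (- (1/8) * (norm z)\<^sup>2)"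
            by simp
          then have "(2 * K * \<bar>e \<bullet> z\<bar> powr (p - 2)) * ((norm z)\<^sup>2 * exp (- (1/4) * (norm z)\<^sup>2))
            \<le> (2 * K * \<bar>e \<bullet> z\<bar> powr (p - 2)) * (exp (2\<^sup>2 / (2 * (1/4))) * exp (- (1/8) * (norm z)\<^sup>2))"
            using K by (intro mult_left_mono) auto
          then show "norm (?h z * exp (- (1/4) * (norm z)\<^sup>2)) \<le>
          norm ((2 * K * exp (2\<^sup>2 / (2 * (1/4)))) * (\<bar>e \<bullet> z\<bar> powr (p - 2) * exp (- (1/8) * (norm z)\<^sup>2)))"
            using K by (simp add: abs_mult mult_ac)
        qed
      qed measurable
    qed (use spp in auto)
  next
    case 3
    have \<gamma>: "s * p < 2 * (p - 1)"
      using 3(3) assms by (simp add: field_simps)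
    let ?h = "\<lambda>z::real^'n. K powr (p - 1) * norm z powr (2 * (p - 1))"
    show ?thesis
    proof (rule finite_case[of ?h, OF _ \<gamma>])
      show "AE z in lborel. \<bar>S z\<bar> \<le> ?h z"
      proof (intro AE_I2)
        fix z show "\<bar>S z\<bar> \<le> ?h z" using flat[OF 3(2), of z] flat[OF 3(2), of "- z"] by (simp add: S_def abs_le_iff)
      qed
      show "integrable lborel (\<lambda>z. ?h z * exp (- (1/4) * (norm z)\<^sup>2))"
        unfolding mult.assoc using assms by (intro integrable_mult_right integrable_powr_gaussian) auto
    qed (auto simp: powr_mult)
  next
    case 4
    have \<gamma>: "s * p = 2 * (p - 1)"
      using 4(3) assms by (simp add: field_simps)
    have f_le: "\<bar>f z\<bar> \<le> K powr (p - 1) * norm z powr (s * p)" for z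
      using flat[OF 4(2)] by (simp only: \<gamma>)
    \<comment> \<open>\<open>Phi p\<close> of the second-order part of
      \<open>u x0 - u (x0 + w)\<close> at vanishing gradient; its degree \<open>2 * (p - 1)\<close>
      is exactly \<open>s * p\<close>.\<close>
    define q where "q w = Phi p (- (1/2) * (w \<bullet> (H x0 *v w)))" for w
    have "(\<lambda>w. w \<bullet> (H x0 *v w)) \<in> borel_measurable borel"
      by (intro borel_measurable_continuous_onI continuous_intros matrix_vector_mult_linear_continuous_on)
    then have qm: "q \<in> borel_measurable borel" unfolding q_def by measurable
    have q_le: "\<bar>q w\<bar> \<le> K powr (p - 1) * norm w powr (s * p)" for w
      unfolding q_def abs_Phi \<gamma> sq_powr[symmetric]
      using HK[of w x0] assms(3) by (intro powr_mono2) auto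
    have q_hom: "q (c *\<^sub>R w) = c powr (s * p) * q w" if "c > 0" for c w
    proof -
      have "- (1/2) * ((c *\<^sub>R w) \<bullet> (H x0 *v (c *\<^sub>R w))) = c\<^sup>2 * (- (1/2) * (w \<bullet> (H x0 *v w)))"
        by (simp add: matrix_vector_mult_scaleR power2_eq_square)
      then have "q (c *\<^sub>R w) = Phi p (c\<^sup>2) * q w" unfolding q_def by (simp only: Phi_mult)
      also have "Phi p (c\<^sup>2) = (c powr 2) powr (p - 1)" using that by (simp add: Phi_nonneg)
      finally show ?thesis by (simp only: powr_powr \<gamma>)
    qed
    have ray: "((\<lambda>t. t powr (- (s * p) / 2) * f (sqrt t *\<^sub>R w)) \<longlongrightarrow> q w) (at_right 0)" for w
    proof -
      \<comment> \<open>The intermediate point is chosen for each \<open>t\<close> separately; it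
        tends to \<open>x0\<close> merely because its distance to \<open>x0\<close> is at most
        \<open>sqrt t * norm w\<close>.\<close>
      have "\<forall>t. \<exists>\<xi>\<in>{0..1}. u (x0 + sqrt t *\<^sub>R w) - u x0 =
          e \<bullet> (sqrt t *\<^sub>R w) + 1/2 * ((sqrt t *\<^sub>R w) \<bullet> (H (x0 + \<xi> *\<^sub>R sqrt t *\<^sub>R w) *v (sqrt t *\<^sub>R w)))"
        using taylor by blast
      then obtain \<xi> where \<xi>: "\<And>t. \<xi> t \<in> {0..1}"
        "\<And>t. u (x0 + sqrt t *\<^sub>R w) - u x0 =
          e \<bullet> (sqrt t *\<^sub>R w) + 1/2 * ((sqrt t *\<^sub>R w) \<bullet> (H (x0 + \<xi> t *\<^sub>R sqrt t *\<^sub>R w) *v (sqrt t *\<^sub>R w)))"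
        by metis
      define y where "y t = x0 + \<xi> t *\<^sub>R sqrt t *\<^sub>R w" for t
      have "((\<lambda>t. \<xi> t *\<^sub>R sqrt t *\<^sub>R w) \<longlongrightarrow> 0) (at_right 0)"
      proof (rule Lim_null_comparison)
        show "\<forall>\<^sub>F t in at_right 0. norm (\<xi> t *\<^sub>R sqrt t *\<^sub>R w) \<le> sqrt t * norm w"
          using eventually_at_right_less[of 0]
        proof eventually_elim
          case (elim t)
          then show ?case using \<xi>(1)[of t] by (simp add: mult_left_le_one_le)
        qed
        have "((\<lambda>t. sqrt t * norm w) \<longlongrightarrow> sqrt 0 * norm w) (at_right 0)"
          by (intro tendsto_intros)
        then show "((\<lambda>t. sqrt t * norm w) \<longlongrightarrow> 0) (at_right 0)" by simp
      qed
      then have "(y \<longlongrightarrow> x0) (at_right 0)"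
        unfolding y_def using tendsto_add[OF tendsto_const] by fastforce
      then have Hy: "((\<lambda>t. H (y t)) \<longlongrightarrow> H x0) (at_right 0)"
        using cH by (intro isCont_tendsto_compose[of x0 H]) (auto simp: continuous_on_eq_continuous_at)
      have "((\<lambda>t. H (y t) *v w) \<longlongrightarrow> H x0 *v w) (at_right 0)"
        unfolding matrix_vector_mult_def
        by (intro tendsto_vec_lambda tendsto_sum tendsto_mult tendsto_const tendsto_vec_nth Hy)
      then have "((\<lambda>t. Phi p (- (1/2) * (w \<bullet> (H (y t) *v w)))) \<longlongrightarrow> q w) (at_right 0)"
        unfolding q_def
        by (intro isCont_tendsto_compose[OF isCont_Phi] tendsto_intros assms)
      then show ?thesis
      proof (rule Lim_transform_eventually)
        show "\<forall>\<^sub>F t in at_right 0. Phi p (- (1/2) * (w \<bullet> (H (y t) *v w))) = t powr (- (s * p) / 2) * f (sqrt t *\<^sub>R w)"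
          using eventually_at_right_less[of 0]
        proof eventually_elim
          case (elim t)
          \<comment> \<open>The factor \<open>t\<close> leaves \<open>Phi p\<close> as
            \<open>t powr (p - 1)\<close>, which \<open>t powr (- (s * p) / 2)\<close> cancels at
            the critical exponent.\<close>
          have "u x0 - u (x0 + sqrt t *\<^sub>R w) = - (u (x0 + sqrt t *\<^sub>R w) - u x0)" by simp
          also have "\<dots> = t * (- (1/2) * (w \<bullet> (H (y t) *v w)))"
            unfolding \<xi>(2) y_def[symmetric] using elim 4(2) by (simp add: matrix_vector_mult_scaleR)
          finally have "f (sqrt t *\<^sub>R w) = Phi p t * Phi p (- (1/2) * (w \<bullet> (H (y t) *v w)))"
            unfolding f_def by (simp only: Phi_mult)
          moreover have "t powr (- (s * p) / 2) * Phi p t = 1"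
          proof -
            have "t powr (- (s * p) / 2) * Phi p t = t powr (- (s * p) / 2 + (p - 1))"
              unfolding powr_add using elim by (simp add: Phi_nonneg)
            also have "- (s * p) / 2 + (p - 1) = 0" unfolding \<gamma> by (simp add: field_simps)
            finally show ?thesis using elim by simp
          qed
          ultimately show ?case by (simp add: mult.assoc[symmetric])
        qed
      qed
    qed
    obtain c D where
      "((\<lambda>\<delta>. (LINT t:{\<delta><..}|lborel. \<integral>z. f z * heat_weight ((real DIM(real^'n) + s * p) / 2) (norm z) t \<partial>lborel) -
        4 powr ((real DIM(real^'n) + s * p) / 2) * Gamma ((real DIM(real^'n) + s * p) / 2) * (\<integral>z. indicator {z. norm z > sqrt \<delta>} z * (f z / norm z powr (real DIM(real^'n) + s * p)) \<partial>lborel))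
        \<longlongrightarrow> D) (at_right 0)"
      "((\<lambda>t. t * (\<integral>z. f z * heat_weight ((real DIM(real^'n) + s * p) / 2) (norm z) t \<partial>lborel)) \<longlongrightarrow> c) (at_right 0)"
      "c = 0 \<Longrightarrow> D = 0"
    proof (rule heat_minus_truncated_kernel[OF fm qm bnd sp f_le q_le _ ray], goal_cases)
      case (1 c z)
      show ?case by (rule q_hom) (rule 1(2))
    next
      case (2 c D)
      show ?case by (rule 2(1)) (rule 2(2-4), assumption?)+
    qed
    note D = this[unfolded f_def, simplified DIM_cart DIM_real mult_1_right]
    have "extended_identity C1 s p u x0"
      by (rule extended_identity_critical[where ?C1.0 = C1, OF sp assms(4) um bnd[unfolded f_def] D(1,2)]) (rule D(3))
    \<comment> \<open>Here the premise of the first conjunct fails, so that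
      \<open>extended_identity\<close> is all that remains.\<close>
    then show ?thesis using 4 by (simp add: e_def)
  qed
qed

end
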